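(* Let $\mathcal{A}$ be a Banach algebra and let $\varphi\in\mathcal{A}^{*}$. (A) The following conditions are equivalent: (A1) $\varphi$ is weakly almost periodic; (A2) $\varphi\circledast B_{\mathcal{A}}$ is relatively weakly compact in $\mathcal{A}^{*}$; (A3) the map $\mathcal{O}_{\varphi}^{(l)}\colon\mathcal{A}^{**}\to\mathcal{A}^{*}$ is (weak-star, weak) continuous; (A4) for every $\nu\in B_{\mathcal{A}^{**}}$ the map $\boxdot_{\nu}^{(r)}\colon\mathcal{A}^{**}\to\mathcal{A}^{**}$ is (weak-star, $\rho_{\varphi}$) continuous; (A5) $B_{\mathcal{A}^{**}}\circledast\varphi$ is weakly compact in $\mathcal{A}^{*}$. (B) The following conditions are equivalent: (B1) $\varphi$ is right Asplund; (B2) $\varphi\circledast B_{\mathcal{A}}$ is an Asplund subset of $\mathcal{A}^{*}$; (B3) the map $\mathcal{O}_{\varphi}^{(l)}$ is (weak-star, norm) fragmented over $B_{\mathcal{A}^{**}}$; (B4) the family $\{\boxdot_{\nu}^{(r)}\}_{\nu\in B_{\mathcal{A}^{**}}}$ is a (weak-star, $\rho_{\varphi}$) fragmented family over $B_{\mathcal{A}^{**}}$. If moreover $\mathcal{A}$ is separable, these are also equivalent to: (B5) $B_{\mathcal{A}^{**}}\circledast\varphi$ is norm separable. (C) The following conditions are equivalent: (C1) $\varphi$ is right tame; (C2) $\varphi\circledast B_{\mathcal{A}}$ is a tame subset of $\mathcal{A}^{*}$; (C3) $B_{\mathcal{A}^{**}}\circledast\varphi$ is co-tame.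
   Context: All vector spaces are over $\mathbb{R}$. $B_{V}$ denotes the closed unit ball of a Banach space $V$; $V$ is regarded as a subspace of $V^{**}$. Actions and first Arens product. For $a,b\in\mathcal{A}$, $\varphi\in\mathcal{A}^{*}$: $\langle a\circledast\varphi,b\rangle:=\langle\varphi,ba\rangle$ and $\langle\varphi\circledast a,b\rangle:=\langle\varphi,ab\rangle$. For $\mu\in\mathcal{A}^{**}$: $\langle\mu\circledast\varphi,b\rangle:=\langle\mu,\varphi\circledast b\rangle$. For $\mu,\nu\in\mathcal{A}^{**}$: $\langle\mu\boxdot\nu,\varphi\rangle:=\langle\mu,\nu\circledast\varphi\rangle$. For sets, $B_{\mathcal{A}}\circledast\varphi=\{a\circledast\varphi: a\in B_{\mathcal{A}}\}$, $\varphi\circledast B_{\mathcal{A}}=\{\varphi\circledast a: a\in B_{\mathcal{A}}\}$ and $B_{\mathcal{A}^{**}}\circledast\varphi=\{\mu\circledast\varphi:\mu\in B_{\mathcal{A}^{**}}\}$. Set $\mathcal{O}_{\varphi}^{(l)}(\mu):=\mu\circledast\varphi$ and $\boxdot_{\nu}^{(r)}(\mu):=\nu\boxdot\mu$. The seminorm $\rho_{\varphi}$ on $\mathcal{A}^{**}$ is $\rho_{\varphi}(\mu)=|\langle\mu,\varphi\rangle|$; the topology and pseudometric it induces are used when writing "(weak-star, $\rho_\varphi$)". The set $B_{\mathcal{A}^{**}}\circledast\varphi$ is weak-star compact. Fragmentability. Let $X$ be a topological space and $(M,d)$ a (pseudo)metric space. A map $f\colon X\to M$ is fragmented if for every nonempty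 $A\subseteq X$ and $\varepsilon>0$ there is an open $O\subseteq X$ with $O\cap A\neq\emptyset$ and $\mathrm{diam}_{d}f(O\cap A)<\varepsilon$. A family of maps $X\to M$ is a fragmented family if for all such $A,\varepsilon$ one can choose a single $O$ that works simultaneously for all maps of the family. "(weak-star, norm) fragmented over $B_{\mathcal{A}^{**}}$" means that the restriction to $X=(B_{\mathcal{A}^{**}},w^{*})$ is fragmented with respect to the norm metric on the target; similarly for $\rho_{\varphi}$. Asplund and tame subsets. A bounded family $\{f_{n}\}_{n\in\mathbb{N}}$ of real functions on a set $X$ is independent if there are reals $a<b$ such that for all finite disjoint $N,M\subseteq\mathbb{N}$ there is $x\in X$ with $f_{n}(x)\le a$ for $n\in N$ and $f_{m}(x)\ge b$ for $m\in M$. A bounded subset $C$ of a Banach space $V$ is Asplund if $C$ is a fragmented family of functions on $(B_{V^{*}},w^{*})$; equivalently, for every countable $D\subseteq C$ the pseudometric space $(B_{V^{*}},\rho_{D})$ is separable, where $\rho_{D}(\varphi,\psi)=\sup_{x\in D}|\langle\varphi-\psi,x\rangle|$. It is tame if it contains no $\ell^{1}$-sequence; equivalently, $C$ contains no sequence that is independent over $B_{V^{*}}$. A weak-star compact subset $M\subseteq V^{*}$ is co-tame if $B_{V}$ is tame as a family of functions on $M$, i.e. $B_{V}$ contains no sequence that is independent over $M$. Classes of functionals. $\varphi\in\mathcal{A}^{*}$ is weakly almost periodic if $B_{\mathcal{A}}\circledast\varphi$ is relatively weakly compact in $\mathcal{A}^{*}$ (its weak closure is weakly compact); right Asplund if $\varphi\circledast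 B_{\mathcal{A}}$ is an Asplund subset of $\mathcal{A}^{*}$; right tame if $\varphi\circledast B_{\mathcal{A}}$ is a tame subset of $\mathcal{A}^{*}$. *)

theory Defs
  imports "HOL-Analysis.Analysis"
begin

type_synonym 'v dual = "'v \<Rightarrow>\<^sub>L real"
type_synonym 'v bidual = "('v \<Rightarrow>\<^sub>L real) \<Rightarrow>\<^sub>L real"


text \<open>Products are not assumed to have a unit. Since \<open>Blinfun\<close> is only meaningful on bounded linear
  functions, each definition is followed by the evaluation rule that characterises it.\<close>

definition act_left :: "'a::real_normed_algebra \<Rightarrow> 'a dual \<Rightarrow> 'a dual"
  where "act_left a \<phi> = Blinfun (\<lambda>b. \<phi> (b * a))"

definition act_right :: "'a::real_normed_algebra dual \<Rightarrow> 'a \<Rightarrow> 'a dual"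
  where "act_right \<phi> a = Blinfun (\<lambda>b. \<phi> (a * b))"

definition act_bidual :: "'a::real_normed_algebra bidual \<Rightarrow> 'a dual \<Rightarrow> 'a dual"
  where "act_bidual \<mu> \<phi> = Blinfun (\<lambda>b. \<mu> (act_right \<phi> b))"

definition arens :: "'a::real_normed_algebra bidual \<Rightarrow> 'a bidual \<Rightarrow> 'a bidual"
  where "arens \<mu> \<nu> = Blinfun (\<lambda>\<phi>. \<mu> (act_bidual \<nu> \<phi>))"

lemma act_left_apply [simp]: "act_left a \<phi> b = \<phi> (b * a)"
  unfolding act_left_def
  by (intro bounded_linear_Blinfun_apply[THEN fun_cong] bounded_linear_intros)

lemma act_right_apply [simp]: "act_right \<phi> a b = \<phi> (a * b)"
  unfolding act_right_def
  by (intro bounded_linear_Blinfun_apply[THEN fun_cong] bounded_linear_intros)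

lemma norm_act_right_le: "norm (act_right \<phi> a) \<le> norm \<phi> * norm a"
proof (rule norm_blinfun_bound)
  fix b
  have "norm (\<phi> (a * b)) \<le> norm \<phi> * norm (a * b)"
    by (rule norm_blinfun)
  also have "\<dots> \<le> norm \<phi> * (norm a * norm b)"
    by (intro mult_left_mono norm_mult_ineq) auto
  finally show "norm (act_right \<phi> a b) \<le> norm \<phi> * norm a * norm b"
    by (simp add: mult.assoc)
qed simp

lemma bounded_bilinear_act_right: "bounded_bilinear act_right"
proof
  show "\<exists>K. \<forall>\<phi> (a :: 'a). norm (act_right \<phi> a) \<le> norm \<phi> * norm a * K"
    using norm_act_right_le by (intro exI[of _ 1]) auto
qed (auto intro!: blinfun_eqI simp: blinfun.bilinear_simps algebra_simps)

lemma act_bidual_apply [simp]: "act_bidual \<mu> \<phi> b = \<mu> (act_right \<phi> b)"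
  unfolding act_bidual_def
  by (intro bounded_linear_Blinfun_apply[THEN fun_cong] bounded_linear_compose[OF blinfun.bounded_linear_right]
      bounded_bilinear.bounded_linear_right[OF bounded_bilinear_act_right])

lemma norm_act_bidual_le: "norm (act_bidual \<mu> \<phi>) \<le> norm \<mu> * norm \<phi>"
proof (rule norm_blinfun_bound)
  fix b
  have "norm (\<mu> (act_right \<phi> b)) \<le> norm \<mu> * norm (act_right \<phi> b)"
    by (rule norm_blinfun)
  also have "\<dots> \<le> norm \<mu> * (norm \<phi> * norm b)"
    by (intro mult_left_mono norm_act_right_le) auto
  finally show "norm (act_bidual \<mu> \<phi> b) \<le> norm \<mu> * norm \<phi> * norm b"
    by (simp add: mult.assoc)
qed simp

lemma bounded_bilinear_act_bidual: "bounded_bilinear act_bidual"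
proof
  show "\<exists>K. \<forall>\<mu> (\<phi> :: 'a dual). norm (act_bidual \<mu> \<phi>) \<le> norm \<mu> * norm \<phi> * K"
    using norm_act_bidual_le by (intro exI[of _ 1]) auto
qed (auto intro!: blinfun_eqI
      simp: blinfun.bilinear_simps bounded_bilinear.add_left[OF bounded_bilinear_act_right]
        bounded_bilinear.scaleR_left[OF bounded_bilinear_act_right])

lemma arens_apply [simp]: "arens \<mu> \<nu> \<phi> = \<mu> (act_bidual \<nu> \<phi>)"
  unfolding arens_def
  by (intro bounded_linear_Blinfun_apply[THEN fun_cong] bounded_linear_compose[OF blinfun.bounded_linear_right]
      bounded_bilinear.bounded_linear_right[OF bounded_bilinear_act_bidual])


text \<open>For scalar-valued operators the strong operator topology is the topology of pointwise
  convergence on the dual space, i.e. the weak-star topology.\<close>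

abbreviation weak_star_topology :: "'v::real_normed_vector dual topology"
  where "weak_star_topology \<equiv> strong_operator_topology"

text \<open>The coarsest topology making every element of the dual space continuous.\<close>

definition weak_topology :: "'v::real_normed_vector topology"
  where "weak_topology = pullback_topology UNIV (\<lambda>x (f :: 'v dual). f x) euclidean"

definition relatively_weakly_compact :: "'v::real_normed_vector set \<Rightarrow> bool"
  where "relatively_weakly_compact S \<longleftrightarrow> compactin weak_topology (weak_topology closure_of S)"

text \<open>Pseudometrics are plain functions \<open>d\<close>; the two instances used are \<^const>\<open>dist\<close> and
  \<open>rho_dist \<phi>\<close> below.\<close>

definition pseudometric_topology :: "('m \<Rightarrow> 'm \<Rightarrow> real) \<Rightarrow> 'm topology"
  where "pseudometric_topology d = topology_generated_by {{y. d x y < r} | x r. r > 0}"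

definition rho :: "'v::real_normed_vector \<Rightarrow> 'v dual \<Rightarrow> real"
  where "rho \<phi> \<mu> = \<bar>\<mu> \<phi>\<bar>"

definition rho_dist :: "'v::real_normed_vector \<Rightarrow> 'v dual \<Rightarrow> 'v dual \<Rightarrow> real"
  where "rho_dist \<phi> \<mu> \<nu> = rho \<phi> (\<mu> - \<nu>)"


text \<open>The diameter is extended-valued, so that an unbounded set has infinite diameter.\<close>

definition ediam :: "('m \<Rightarrow> 'm \<Rightarrow> real) \<Rightarrow> 'm set \<Rightarrow> ennreal"
  where "ediam d S = (SUP x\<in>S. SUP y\<in>S. ennreal (d x y))"

definition fragmented :: "'x topology \<Rightarrow> ('m \<Rightarrow> 'm \<Rightarrow> real) \<Rightarrow> ('x \<Rightarrow> 'm) \<Rightarrow> bool"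
  where "fragmented X d f \<longleftrightarrow>
    (\<forall>A \<epsilon>. A \<subseteq> topspace X \<and> A \<noteq> {} \<and> \<epsilon> > 0 \<longrightarrow>
      (\<exists>U. openin X U \<and> U \<inter> A \<noteq> {} \<and> ediam d (f ` (U \<inter> A)) < ennreal \<epsilon>))"

definition fragmented_family :: "'x topology \<Rightarrow> ('m \<Rightarrow> 'm \<Rightarrow> real) \<Rightarrow> ('x \<Rightarrow> 'm) set \<Rightarrow> bool"
  where "fragmented_family X d F \<longleftrightarrow>
    (\<forall>A \<epsilon>. A \<subseteq> topspace X \<and> A \<noteq> {} \<and> \<epsilon> > 0 \<longrightarrow>
      (\<exists>U. openin X U \<and> U \<inter> A \<noteq> {} \<and> (\<forall>f\<in>F. ediam d (f ` (U \<inter> A)) < ennreal \<epsilon>)))"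


definition asplund_subset :: "'v::real_normed_vector set \<Rightarrow> bool"
  where "asplund_subset C \<longleftrightarrow> bounded C \<and>
    fragmented_family (subtopology weak_star_topology (cball 0 1)) dist
      ((\<lambda>x (f :: 'v dual). f x) ` C)"

text \<open>Sequences equivalent to the unit vector basis of \<open>\<ell>\<^sup>1\<close>.\<close>

definition l1_sequence :: "(nat \<Rightarrow> 'v::real_normed_vector) \<Rightarrow> bool"
  where "l1_sequence x \<longleftrightarrow>
    (\<exists>c>0. \<exists>K>0. \<forall>n (t :: nat \<Rightarrow> real).
      c * (\<Sum>i<n. \<bar>t i\<bar>) \<le> norm (\<Sum>i<n. t i *\<^sub>R x i) \<and>
      norm (\<Sum>i<n. t i *\<^sub>R x i) \<le> K * (\<Sum>i<n. \<bar>t i\<bar>))"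

definition tame_subset :: "'v::real_normed_vector set \<Rightarrow> bool"
  where "tame_subset C \<longleftrightarrow> bounded C \<and> \<not> (\<exists>x. range x \<subseteq> C \<and> l1_sequence x)"

definition independent_on :: "'x set \<Rightarrow> (nat \<Rightarrow> 'x \<Rightarrow> real) \<Rightarrow> bool"
  where "independent_on X f \<longleftrightarrow>
    (\<exists>K. \<forall>n. \<forall>x\<in>X. \<bar>f n x\<bar> \<le> K) \<and>
    (\<exists>a b. a < b \<and>
      (\<forall>N M. finite N \<and> finite M \<and> N \<inter> M = {} \<longrightarrow>
        (\<exists>x\<in>X. (\<forall>n\<in>N. f n x \<le> a) \<and> (\<forall>m\<in>M. f m x \<ge> b))))"

definition co_tame :: "'v::real_normed_vector dual set \<Rightarrow> bool"
  where "co_tame M \<longleftrightarrow> compactin weak_star_topology M \<and>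
    \<not> (\<exists>x :: nat \<Rightarrow> 'v. range x \<subseteq> cball 0 1 \<and> independent_on M (\<lambda>n f. f (x n)))"


definition weakly_almost_periodic :: "'a::real_normed_algebra dual \<Rightarrow> bool"
  where "weakly_almost_periodic \<phi> \<longleftrightarrow>
    relatively_weakly_compact ((\<lambda>a. act_left a \<phi>) ` cball 0 1)"

definition right_asplund :: "'a::real_normed_algebra dual \<Rightarrow> bool"
  where "right_asplund \<phi> \<longleftrightarrow> asplund_subset (act_right \<phi> ` cball 0 1)"

definition right_tame :: "'a::real_normed_algebra dual \<Rightarrow> bool"
  where "right_tame \<phi> \<longleftrightarrow> tame_subset (act_right \<phi> ` cball 0 1)"

end

theory Submission
  imports Defs
begin

text \<open>Let \<open>S x = \<phi> \<circledast> x\<close> and \<open>T y = y \<circledast> \<phi>\<close>, so that \<open>S x y = T y x\<close>, and \<open>\<mu> \<circledast> \<phi>\<close> is the composition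
  \<open>\<mu> \<circ> S\<close>, the adjoint of \<open>S\<close> at \<open>\<mu>\<close>. All three parts concern this operator only.

  (A) All conditions amount to the identity \<open>\<nu> (\<mu> \<circ> S) = \<mu> (\<nu> \<circ> T)\<close> for \<open>\<mu>, \<nu>\<close> in the bidual, which is
  symmetric in \<open>S\<close> and \<open>T\<close>; it makes the adjoint weak-star to weak continuous, and it follows from
  relative weak compactness by Goldstine's theorem.

  (B) The norm distance of \<open>\<mu> \<circ> S\<close> and \<open>\<mu>' \<circ> S\<close> is a supremum over the unit ball of \<open>\<A>\<close>, and equally
  over that of the bidual. For separable \<open>\<A>\<close> the image of the bidual ball is weak-star metrizable;
  one implication of (B5) is a Lindeloef argument there, the other one is Baire's theorem.

  (C) By a direct estimate independent sequences are \<open>\<ell>\<^sup>1\<close>-sequences. The converse asks for functionals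
  with prescribed signs on an \<open>\<ell>\<^sup>1\<close>-sequence in a dual space, and Helly's theorem provides them
  without the Hahn-Banach theorem.\<close>

subsection \<open>Weak-star and weak topologies\<close>

text \<open>The canonical embedding of a space into its bidual.\<close>

definition eval_at :: "'v::real_normed_vector \<Rightarrow> 'v bidual"
  where "eval_at x = Blinfun (\<lambda>f :: 'v dual. f x)"

lemma eval_at_apply [simp]: "eval_at x f = f x"
  unfolding eval_at_def by (simp add: bounded_linear_Blinfun_apply blinfun.bounded_linear_left)

lemma norm_eval_at_le: "norm (eval_at x) \<le> norm x"
proof (rule norm_blinfun_bound)
  show "norm (eval_at x f) \<le> norm x * norm f" for f
    using norm_blinfun[of f x] by (simp add: mult.commute)
qed simp

lemma topspace_weak_star [simp]: "topspace weak_star_topology = UNIV"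
  by (rule strong_operator_topology_topspace)

lemma topspace_weak_topology [simp]: "topspace weak_topology = UNIV"
  by (simp add: weak_topology_def topspace_pullback_topology)

lemma continuous_map_weak_topology_iff:
  fixes f :: "'x \<Rightarrow> 'v::real_normed_vector"
  shows "continuous_map X weak_topology f \<longleftrightarrow> (\<forall>\<nu> :: 'v dual. continuous_map X euclidean (\<lambda>x. \<nu> (f x)))"
proof (intro iffI allI)
  fix \<nu> :: "'v dual"
  assume f: "continuous_map X weak_topology f"
  have "continuous_map weak_topology euclidean ((\<lambda>h. h \<nu>) \<circ> (\<lambda>x (\<nu> :: 'v dual). \<nu> x))"
    unfolding weak_topology_def
    by (rule continuous_map_pullback) (use continuous_on_product_coordinates in fastforce)
  from continuous_map_compose[OF f this] show "continuous_map X euclidean (\<lambda>x. \<nu> (f x))"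
    by (simp add: comp_def)
next
  assume "\<forall>\<nu> :: 'v dual. continuous_map X euclidean (\<lambda>x. \<nu> (f x))"
  then have "continuous_map X euclidean ((\<lambda>x (\<nu> :: 'v dual). \<nu> x) \<circ> f)"
    unfolding euclidean_product_topology[symmetric] comp_def
    by (simp add: continuous_map_componentwise_UNIV)
  then show "continuous_map X weak_topology f"
    unfolding weak_topology_def by (rule continuous_map_pullback') auto
qed

lemma Hausdorff_weak_star: "Hausdorff_space (weak_star_topology :: 'v::real_normed_vector dual topology)"
proof (rule Hausdorff_space_injective_preimage)
  show "continuous_map weak_star_topology (product_topology (\<lambda>_. euclidean) UNIV) (blinfun_apply :: 'v dual \<Rightarrow> 'v \<Rightarrow> real)"
    by (simp add: continuous_map_componentwise_UNIV strong_operator_topology_continuous_evaluation)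
qed (auto simp: inj_on_def blinfun_apply_inject Hausdorff_space_product_topology)

text \<open>Evaluation at a vector is itself a bidual element, via \<open>eval_at\<close>, so on a
  dual the weak topology refines the weak-star topology.\<close>

lemma continuous_map_weak_weak_star:
  "continuous_map (weak_topology :: 'v::real_normed_vector dual topology) weak_star_topology (\<lambda>f. f)"
proof -
  have "continuous_map weak_topology weak_topology (\<lambda>f :: 'v dual. f)"
    by simp
  then have "continuous_map weak_topology euclidean (\<lambda>f :: 'v dual. eval_at x f)" for x
    unfolding continuous_map_weak_topology_iff by blast
  then show ?thesis
    by (simp add: continuous_on_strong_operator_topo_iff_coordinatewise)
qed

lemma Hausdorff_weak: "Hausdorff_space (weak_topology :: 'v::real_normed_vector dual topology)"
  by (rule Hausdorff_space_injective_preimage[OF Hausdorff_weak_star continuous_map_weak_weak_star]) simp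

text \<open>A basic open set of the product topology restricts finitely many coordinates, and the
  least of the radii there works for all of them. Helly's theorem can meet conditions of this finite
  form.\<close>

lemma weak_star_nbhd_basis:
  fixes f :: "'v::real_normed_vector dual"
  assumes "openin weak_star_topology U" "f \<in> U"
  obtains I e where "finite I" "e > 0" "{g :: 'v dual. \<forall>x\<in>I. \<bar>g x - f x\<bar> < e} \<subseteq> U"
proof -
  obtain V :: "('v \<Rightarrow> real) set" where V: "open V" "U = blinfun_apply -` V"
    using assms(1) by (auto simp: strong_operator_topology_def openin_pullback_topology)
  have "openin (product_topology (\<lambda>_ :: 'v. euclidean :: real topology) UNIV) V" "blinfun_apply f \<in> V"
    using V assms(2) by (auto simp: euclidean_product_topology)
  from product_topology_open_contains_basis[OF this]
  obtain X where X: "\<And>i. f i \<in> X i" "\<And>i. open (X i)" "finite {i. X i \<noteq> UNIV}" "(\<Pi>\<^sub>E i\<in>UNIV. X i) \<subseteq> V"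
    by auto
  define I where "I = {i. X i \<noteq> UNIV}"
  have "\<exists>e>0. \<forall>y. \<bar>y - f i\<bar> < e \<longrightarrow> y \<in> X i" for i
    using X(1,2)[of i] by (auto simp: open_dist dist_real_def)
  then obtain e where e: "\<And>i. e i > 0" "\<And>i y. \<bar>y - f i\<bar> < e i \<Longrightarrow> y \<in> X i"
    by metis
  \<comment> \<open>The inserted 1 keeps the minimum defined when \<open>I\<close> is empty.\<close>
  define d where "d = Min (insert 1 (e ` I))"
  have d: "d > 0" "\<And>i. i \<in> I \<Longrightarrow> d \<le> e i"
    using X(3) e(1) by (auto simp: d_def I_def)
  have "{g :: 'v dual. \<forall>x\<in>I. \<bar>g x - f x\<bar> < d} \<subseteq> U"
  proof
    fix g :: "'v dual" assume "g \<in> {g :: 'v dual. \<forall>x\<in>I. \<bar>g x - f x\<bar> < d}"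
    then have g: "\<And>x. x \<in> I \<Longrightarrow> \<bar>g x - f x\<bar> < d" by blast
    have "g i \<in> X i" for i
    proof (cases "i \<in> I")
      case True
      then show ?thesis using g[OF True] d(2)[OF True] e(2)[of "g i" i] by simp
    qed (simp add: I_def)
    then have "blinfun_apply g \<in> V" using X(4) by auto
    then show "g \<in> U" using V by simp
  qed
  then show thesis using that[of I d] X(3) d(1) unfolding I_def by blast
qed

text \<open>The ball is the image under \<open>Blinfun\<close> of a closed part of a product of
  compact intervals: \<open>P\<close> encodes the norm bound and \<open>Q\<close> linearity.
  Tychonoff's theorem makes \<open>P\<close> compact.\<close>

theorem Banach_Alaoglu: "compactin weak_star_topology (cball 0 1 :: 'v::real_normed_vector dual set)"
proof -
  define P :: "('v \<Rightarrow> real) set" where "P = (\<Pi>\<^sub>E x\<in>UNIV. {- norm x..norm x})"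
  define Q :: "('v \<Rightarrow> real) set" where
    "Q = {h. \<forall>x y. h (x + y) = h x + h y} \<inter> {h. \<forall>c x. h (c *\<^sub>R x) = c * h x}"
  have "compactin (product_topology (\<lambda>_. euclidean) UNIV) P"
    unfolding P_def compactin_PiE by (auto simp: compactin_euclidean_iff)
  then have P: "compact P"
    by (simp add: euclidean_product_topology compactin_euclidean_iff)
  have cont: "continuous_on UNIV (\<lambda>h :: 'v \<Rightarrow> real. h x)" for x :: 'v
    by (rule continuous_on_product_coordinates)
  have "closed Q"
    unfolding Q_def
    by (intro closed_Int closed_Collect_all closed_Collect_eq continuous_on_add continuous_on_mult
        continuous_on_const continuous_on_product_coordinates)
  then have "compactin euclidean (P \<inter> Q)"
    using P by (simp add: compact_Int_closed compactin_euclidean_iff)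
  then have PQ: "compactin (top_of_set (P \<inter> Q)) (P \<inter> Q)"
    by (simp add: compactin_subtopology)
  have bl: "bounded_linear h" "norm (Blinfun h) \<le> 1" if "h \<in> P \<inter> Q" for h
  proof -
    have h: "\<bar>h x\<bar> \<le> norm x" for x
      using that by (auto simp: P_def abs_le_iff dest: PiE_mem[of _ _ _ x])
    then show "bounded_linear h"
      using that by (intro bounded_linear_intro[where K = 1]) (auto simp: Q_def)
    then show "norm (Blinfun h) \<le> 1"
      using h by (intro norm_blinfun_bound) (auto simp: bounded_linear_Blinfun_apply)
  qed
  have "continuous_map (top_of_set (P \<inter> Q)) weak_star_topology Blinfun"
    unfolding continuous_on_strong_operator_topo_iff_coordinatewise
  proof
    fix x :: 'v
    have "continuous_map (top_of_set (P \<inter> Q)) euclidean (\<lambda>h. h x)"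
      using continuous_on_subset[OF cont] by auto
    then show "continuous_map (top_of_set (P \<inter> Q)) euclidean (\<lambda>h. Blinfun h x)"
      by (rule continuous_map_eq) (simp add: bounded_linear_Blinfun_apply bl)
  qed
  from image_compactin[OF PQ this] have "compactin weak_star_topology (Blinfun ` (P \<inter> Q))" .
  moreover have "Blinfun ` (P \<inter> Q) = cball 0 1"
  proof (intro equalityI subsetI)
    fix f :: "'v dual" assume f: "f \<in> cball 0 1"
    have "\<bar>f x\<bar> \<le> norm x" for x
      using norm_blinfun[of f x] mult_right_mono[of "norm f" 1 "norm x"] f by simp
    then have "blinfun_apply f \<in> P \<inter> Q"
      by (auto simp: P_def Q_def blinfun.bilinear_simps abs_le_iff minus_le_iff)
    then show "f \<in> Blinfun ` (P \<inter> Q)"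
      by (metis blinfun_apply_inverse image_eqI)
  qed (use bl in auto)
  ultimately show ?thesis by simp
qed

lemma compact_space_weak_star_ball:
  "compact_space (subtopology weak_star_topology (cball 0 1 :: 'v::real_normed_vector dual set))"
  using Banach_Alaoglu by (simp add: compactin_subspace)

text \<open>Balls of \<open>rho_dist \<phi>\<close> are preimages of real intervals under evaluation
  at \<open>\<phi>\<close>, so this topology is pulled back from the reals by that
  evaluation.\<close>

lemma continuous_map_pseudometric_topology_rho_dist_iff:
  "continuous_map X (pseudometric_topology (rho_dist \<phi>)) g \<longleftrightarrow> continuous_map X euclidean (\<lambda>x. g x \<phi>)"
proof
  assume g: "continuous_map X (pseudometric_topology (rho_dist \<phi>)) g"
  show "continuous_map X euclidean (\<lambda>x. g x \<phi>)"
    unfolding continuous_map_def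
  proof (intro conjI allI impI)
    fix U :: "real set" assume "openin euclidean U"
    then have U: "open U" by simp
    show "openin X {x \<in> topspace X. g x \<phi> \<in> U}"
    proof (subst openin_subopen, clarify)
      fix x assume x: "x \<in> topspace X" "g x \<phi> \<in> U"
      then obtain e where e: "e > 0" "\<And>t. \<bar>g x \<phi> - t\<bar> < e \<Longrightarrow> t \<in> U"
        using U by (metis dist_commute dist_real_def open_dist)
      have "openin (pseudometric_topology (rho_dist \<phi>)) {y. rho_dist \<phi> (g x) y < e}"
        unfolding pseudometric_topology_def
        by (rule topology_generated_by_Basis) (use e in auto)
      from openin_continuous_map_preimage[OF g this]
      have "openin X {z \<in> topspace X. \<bar>g x \<phi> - g z \<phi>\<bar> < e}"
        by (simp add: rho_dist_def rho_def blinfun.diff_left)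
      then show "\<exists>T. openin X T \<and> x \<in> T \<and> T \<subseteq> {x \<in> topspace X. g x \<phi> \<in> U}"
        using x e by (intro exI[of _ "{z \<in> topspace X. \<bar>g x \<phi> - g z \<phi>\<bar> < e}"]) auto
    qed
  qed auto
next
  assume g: "continuous_map X euclidean (\<lambda>x. g x \<phi>)"
  show "continuous_map X (pseudometric_topology (rho_dist \<phi>)) g"
    unfolding pseudometric_topology_def continuous_on_generated_topo_iff
  proof (intro conjI allI impI)
    fix U assume "U \<in> {{y. rho_dist \<phi> x y < r} | x r. r > 0}"
    then obtain x r where U: "U = {y. rho_dist \<phi> x y < r}" by auto
    have "openin X {z \<in> topspace X. g z \<phi> \<in> ball (x \<phi>) r}"
      by (rule openin_continuous_map_preimage[OF g]) simp
    also have "{z \<in> topspace X. g z \<phi> \<in> ball (x \<phi>) r} = g -` U \<inter> topspace X"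
      by (auto simp: U rho_dist_def rho_def blinfun.diff_left dist_real_def)
    finally show "openin X (g -` U \<inter> topspace X)" .
  next
    have "y \<in> {z. rho_dist \<phi> y z < 1}" for y
      by (simp add: rho_dist_def rho_def)
    then show "g ` topspace X \<subseteq> \<Union> {{y. rho_dist \<phi> x y < r} | x r. r > 0}"
      using zero_less_one by blast
  qed
qed

subsection \<open>Helly's theorem and Goldstine's theorem\<close>

text \<open>A near-minimiser \<open>x\<close> of the squared error \<open>q\<close> over the unit ball almost maximises the functional
  \<open>g = (\<Sum>i\<in>I. (c i - f i x) *\<^sub>R f i)\<close> there; as \<open>q x = (\<Sum>i\<in>I. (c i - f i x) * c i) - g x\<close>, the hypothesis
  on \<open>c\<close> forces \<open>q x\<close> to be small. This replaces a separation theorem.\<close>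

lemma Helly:
  fixes f :: "'i \<Rightarrow> 'v::real_normed_vector dual"
  assumes fin: "finite I"
    and c: "\<And>t. \<bar>\<Sum>i\<in>I. t i * c i\<bar> \<le> norm (\<Sum>i\<in>I. t i *\<^sub>R f i)"
    and e: "e > 0"
  obtains x where "x \<in> cball 0 1" "\<And>i. i \<in> I \<Longrightarrow> \<bar>f i x - c i\<bar> < e"
proof -
  define q where "q x = (\<Sum>i\<in>I. (c i - f i x)\<^sup>2)" for x
  define d where "d = Inf (q ` cball 0 1)"
  have q0: "q x \<ge> 0" for x by (simp add: q_def sum_nonneg)
  have bdd: "bdd_below (q ` cball 0 1)" by (rule bdd_belowI2[where m = 0]) (rule q0)
  have d_le: "d \<le> q x" if "x \<in> cball 0 1" for x
    unfolding d_def using bdd that by (rule cINF_lower)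
  \<comment> \<open>Bounds the quadratic coefficient of \<open>q\<close> along segments in the unit
    ball, where \<open>norm (y - x) \<le> 2\<close>.\<close>
  define C where "C = (\<Sum>i\<in>I. (2 * norm (f i))\<^sup>2)"
  have C0: "C \<ge> 0" by (simp add: C_def sum_nonneg)
  \<comment> \<open>A step of size \<open>s\<close> from a near-minimiser \<open>x\<close> towards
    \<open>y\<close> changes \<open>q\<close> by \<open>- 2 * s * (g y - g x)\<close> up to second
    order. The slack \<open>s\<^sup>2\<close> has that same order, so division by \<open>s\<close>
    leaves an error proportional to \<open>s\<close>.\<close>
  have key: "d \<le> s * (1 + C) / 2" if s: "0 < s" "s \<le> 1" for s
  proof -
    have "\<exists>x\<in>cball 0 1. q x < d + s\<^sup>2"
    proof -
      have "Inf (q ` cball 0 1) < d + s\<^sup>2" using s by (simp add: d_def)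
      then show ?thesis by (subst (asm) cINF_less_iff) (use bdd in auto)
    qed
    then obtain x where x: "norm x \<le> 1" "q x < d + s\<^sup>2" by auto
    define g where "g = (\<Sum>i\<in>I. (c i - f i x) *\<^sub>R f i)"
    have g: "g y = (\<Sum>i\<in>I. (c i - f i x) * f i y)" for y
      unfolding g_def by (simp add: blinfun.sum_left blinfun.scaleR_left)
    have gy: "g y \<le> g x + s * (1 + C) / 2" if y: "norm y \<le> 1" for y
    proof -
      have "x + s *\<^sub>R (y - x) \<in> cball 0 1"
      proof -
        have "norm (x + s *\<^sub>R (y - x)) = norm ((1 - s) *\<^sub>R x + s *\<^sub>R y)"
          by (simp add: algebra_simps)
        also have "\<dots> \<le> (1 - s) * norm x + s * norm y"
          using s by (intro order_trans[OF norm_triangle_ineq]) simp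
        also have "\<dots> \<le> (1 - s) * 1 + s * 1"
          using s x y by (intro add_mono mult_left_mono) auto
        finally show ?thesis by simp
      qed
      then have "d \<le> q (x + s *\<^sub>R (y - x))" by (rule d_le)
      also have "\<dots> = q x - 2 * s * (g y - g x) + s\<^sup>2 * (\<Sum>i\<in>I. (f i (y - x))\<^sup>2)"
        unfolding q_def g sum_subtractf[symmetric] sum_distrib_left sum.distrib[symmetric]
        by (rule sum.cong) (simp_all add: blinfun.bilinear_simps power2_eq_square algebra_simps)
      also have "(\<Sum>i\<in>I. (f i (y - x))\<^sup>2) \<le> C"
        unfolding C_def
      proof (rule sum_mono)
        fix i
        have "\<bar>f i (y - x)\<bar> \<le> norm (f i) * norm (y - x)"
          using norm_blinfun[of "f i" "y - x"] by simp
        also have "\<dots> \<le> norm (f i) * 2"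
          using norm_triangle_ineq4[of y x] x y by (intro mult_left_mono) auto
        finally show "(f i (y - x))\<^sup>2 \<le> (2 * norm (f i))\<^sup>2"
          by (intro abs_le_square_iff[THEN iffD1]) simp
      qed
      finally have "d \<le> q x - 2 * s * (g y - g x) + s\<^sup>2 * C"
        by (simp add: mult_left_mono)
      then have "2 * s * (g y - g x) \<le> s\<^sup>2 + s\<^sup>2 * C" using x by simp
      then have "s * (2 * (g y - g x)) \<le> s * (s * (1 + C))"
        by (simp add: power2_eq_square algebra_simps)
      then have "2 * (g y - g x) \<le> s * (1 + C)" using s by simp
      then show ?thesis by (simp add: field_simps)
    qed
    have "norm g \<le> g x + s * (1 + C) / 2"
    proof (rule norm_blinfun_bound)
      have "g 0 = 0" by (rule blinfun.zero_right)
      then show "0 \<le> g x + s * (1 + C) / 2" using gy[of 0] by simp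
      fix y :: 'v
      show "norm (g y) \<le> (g x + s * (1 + C) / 2) * norm y"
      proof (cases "y = 0")
        case False
        define u where "u = y /\<^sub>R norm y"
        have u: "norm u \<le> 1" "y = norm y *\<^sub>R u" using False by (auto simp: u_def)
        have "\<bar>g u\<bar> \<le> g x + s * (1 + C) / 2"
          using gy[of u] gy[of "-u"] u by (auto simp: blinfun.minus_right abs_le_iff)
        moreover have "norm (g y) = \<bar>g u\<bar> * norm y"
          by (subst u(2)) (simp add: blinfun.scaleR_right abs_mult)
        ultimately show ?thesis by (simp add: mult_right_mono)
      qed (simp add: blinfun.zero_right)
    qed
    \<comment> \<open>The hypothesis on \<open>c\<close> is used with the residuals as coefficients;
      they combine the \<open>f i\<close> to \<open>g\<close>.\<close>
    moreover have "(\<Sum>i\<in>I. (c i - f i x) * c i) \<le> norm g"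
      using c[of "\<lambda>i. c i - f i x"] by (simp add: g_def)
    moreover have "q x = (\<Sum>i\<in>I. (c i - f i x) * c i) - g x"
      unfolding q_def g sum_subtractf[symmetric]
      by (rule sum.cong) (simp_all add: power2_eq_square algebra_simps)
    moreover have "d \<le> q x" using x by (intro d_le) simp
    ultimately show ?thesis by simp
  qed
  have "d \<le> 0"
  proof (rule ccontr)
    assume "\<not> d \<le> 0"
    \<comment> \<open>For this \<open>s\<close> the bound \<open>key\<close> yields
      \<open>d \<le> d / 2\<close>.\<close>
    define s where "s = min 1 (d / (1 + C))"
    have s: "0 < s" "s \<le> 1" "s * (1 + C) \<le> d"
      using \<open>\<not> d \<le> 0\<close> C0 by (auto simp: s_def pos_le_divide_eq[symmetric])
    show False using key[OF s(1,2)] s(3) \<open>\<not> d \<le> 0\<close> by simp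
  qed
  then have "Inf (q ` cball 0 1) < e\<^sup>2" using e by (simp add: d_def order.strict_trans1)
  then have "\<exists>x\<in>cball 0 1. q x < e\<^sup>2" by (subst (asm) cINF_less_iff) (use bdd in auto)
  then obtain x where x: "x \<in> cball 0 1" "q x < e\<^sup>2" by auto
  have "\<bar>f i x - c i\<bar> < e" if "i \<in> I" for i
  proof -
    have "(c i - f i x)\<^sup>2 \<le> q x"
      unfolding q_def using fin that by (intro member_le_sum) auto
    then have "\<bar>f i x - c i\<bar>\<^sup>2 < e\<^sup>2" using x by (simp add: power2_commute)
    then show ?thesis using e by (intro power2_less_imp_less[of _ e]) auto
  qed
  with x show thesis by (intro that) auto
qed

text \<open>A weak-star neighbourhood of \<open>\<mu>\<close> tests finitely many functionals
  \<open>f\<close>. Helly's theorem applies to them with prescribed values \<open>\<mu> f\<close>;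
  its hypothesis follows from \<open>norm \<mu> \<le> 1\<close>.\<close>

theorem Goldstine:
  "cball 0 1 \<subseteq> weak_star_topology closure_of (eval_at ` (cball 0 1 :: 'v::real_normed_vector set))"
proof
  fix \<mu> :: "'v bidual" assume \<mu>: "\<mu> \<in> cball 0 1"
  show "\<mu> \<in> weak_star_topology closure_of (eval_at ` cball 0 1)"
    unfolding in_closure_of
  proof (intro conjI allI impI)
    fix U assume "\<mu> \<in> U \<and> openin weak_star_topology U"
    then obtain I e where Ie: "finite I" "e > 0" "{g :: 'v bidual. \<forall>x\<in>I. \<bar>g x - \<mu> x\<bar> < e} \<subseteq> U"
      using weak_star_nbhd_basis[of U \<mu>] by auto
    have "\<bar>\<Sum>f\<in>I. t f * \<mu> f\<bar> \<le> norm (\<Sum>f\<in>I. t f *\<^sub>R f)" for t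
    proof -
      have "\<bar>\<Sum>f\<in>I. t f * \<mu> f\<bar> = norm (\<mu> (\<Sum>f\<in>I. t f *\<^sub>R f))"
        by (simp add: blinfun.sum_right blinfun.scaleR_right)
      also have "\<dots> \<le> norm \<mu> * norm (\<Sum>f\<in>I. t f *\<^sub>R f)" by (rule norm_blinfun)
      also have "\<dots> \<le> 1 * norm (\<Sum>f\<in>I. t f *\<^sub>R f)" using \<mu> by (intro mult_right_mono) auto
      finally show ?thesis by simp
    qed
    from Helly[where f = "\<lambda>f. f", OF Ie(1) this Ie(2)]
    obtain x where "x \<in> cball 0 1" "\<And>f. f \<in> I \<Longrightarrow> \<bar>f x - \<mu> f\<bar> < e" by metis
    then show "\<exists>y. y \<in> eval_at ` cball 0 1 \<and> y \<in> U"
      using Ie(3) by (intro exI[of _ "eval_at x"]) auto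
  qed simp
qed

subsection \<open>Weakly compact operators into a dual space\<close>

lemma continuous_map_weak_star_adjoint:
  "continuous_map weak_star_topology weak_star_topology (\<lambda>\<mu>. \<mu> o\<^sub>L S)"
  by (simp add: continuous_on_strong_operator_topo_iff_coordinatewise
      strong_operator_topology_continuous_evaluation)

text \<open>On a weakly compact set \<open>K\<close> the weak and weak-star topologies coincide. By Goldstine's theorem
  \<open>K\<close> contains the whole image of the bidual ball, so both sides of the claimed identity are
  weak-star continuous there, and they agree on the dense image of the unit ball.\<close>

lemma bidual_symmetric_if_relatively_weakly_compact:
  fixes S :: "'x::real_normed_vector \<Rightarrow>\<^sub>L 'y::real_normed_vector dual" and T :: "'y \<Rightarrow>\<^sub>L 'x dual"
  assumes ST: "\<And>x y. S x y = T y x"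
    and comp: "relatively_weakly_compact (T ` cball 0 1)"
  shows "(\<nu> :: 'x bidual) (\<mu> o\<^sub>L S) = (\<mu> :: 'y bidual) (\<nu> o\<^sub>L T)"
proof -
  define K where "K = weak_topology closure_of (T ` cball 0 1)"
  define B where "B = subtopology weak_star_topology (cball 0 1 :: 'y bidual set)"
  have K: "compactin weak_topology K"
    using comp by (simp add: relatively_weakly_compact_def K_def)
  have eval: "eval_at y o\<^sub>L S = T y" for y
    by (rule blinfun_eqI) (simp add: ST)
  \<comment> \<open>Compactness passes to the coarser topology, and compact sets are closed in a
    Hausdorff space.\<close>
  have "compactin weak_star_topology ((\<lambda>f. f) ` K)"
    by (rule image_compactin[OF K continuous_map_weak_weak_star])
  then have Kw: "closedin weak_star_topology K"
    using compactin_imp_closedin[OF Hausdorff_weak_star] by simp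
  \<comment> \<open>A continuous bijection from a compact space to a Hausdorff space has a
    continuous inverse.\<close>
  have "homeomorphic_map (subtopology weak_topology K) (subtopology weak_star_topology K) (\<lambda>f. f)"
  proof (rule continuous_imp_homeomorphic_map)
    show "compact_space (subtopology weak_topology K)"
      using K by (simp add: compactin_subspace)
    show "continuous_map (subtopology weak_topology K) (subtopology weak_star_topology K) (\<lambda>f. f)"
      by (auto simp: continuous_map_in_subtopology
          intro: continuous_map_from_subtopology continuous_map_weak_weak_star)
  qed (auto simp: Hausdorff_space_subtopology Hausdorff_weak_star)
  then have "continuous_map (subtopology weak_star_topology K) (subtopology weak_topology K) (\<lambda>f. f)"
    by (smt (verit, best) continuous_map_eq homeomorphic_map_maps homeomorphic_maps_def)
  then have KK: "continuous_map (subtopology weak_star_topology K) weak_topology (\<lambda>f. f)"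
    by (simp add: continuous_map_in_subtopology)
  have "closedin weak_star_topology {\<mu> \<in> topspace weak_star_topology. \<mu> o\<^sub>L S \<in> K}"
    by (rule closedin_continuous_map_preimage[OF continuous_map_weak_star_adjoint Kw])
  moreover have "eval_at ` cball 0 1 \<subseteq> {\<mu> \<in> topspace weak_star_topology. \<mu> o\<^sub>L S \<in> K}"
    using closure_of_subset[of "T ` cball 0 1" weak_topology] by (auto simp: eval K_def)
  ultimately have "weak_star_topology closure_of (eval_at ` cball 0 1) \<subseteq> {\<mu>. \<mu> o\<^sub>L S \<in> K}"
    using closure_of_minimal by fastforce
  then have inK: "\<mu> o\<^sub>L S \<in> K" if "\<mu> \<in> cball 0 1" for \<mu>
    using Goldstine that by blast
  have "continuous_map B (subtopology weak_star_topology K) (\<lambda>\<mu>. \<mu> o\<^sub>L S)"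
    unfolding B_def
    by (intro continuous_map_into_subtopology continuous_map_from_subtopology
        continuous_map_weak_star_adjoint) (use inK in auto)
  from continuous_map_compose[OF this KK] have "continuous_map B weak_topology (\<lambda>\<mu>. \<mu> o\<^sub>L S)"
    by (simp add: comp_def)
  then have c1: "continuous_map B euclidean (\<lambda>\<mu>. \<nu> (\<mu> o\<^sub>L S))"
    by (simp add: continuous_map_weak_topology_iff)
  have c2: "continuous_map B euclidean (\<lambda>\<mu>. \<mu> (\<nu> o\<^sub>L T))"
    unfolding B_def
    by (intro continuous_map_from_subtopology strong_operator_topology_continuous_evaluation)
  have ball: "\<nu> (\<mu> o\<^sub>L S) = \<mu> (\<nu> o\<^sub>L T)" if "\<mu> \<in> cball 0 1" for \<mu>
  proof (rule forall_in_closure_of_eq[OF _ _ c1 c2])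
    have "eval_at ` cball 0 1 \<subseteq> (cball 0 1 :: 'y bidual set)"
      by (auto intro: order_trans[OF norm_eval_at_le])
    then show "\<mu> \<in> B closure_of (eval_at ` cball 0 1)"
      unfolding B_def using Goldstine that by (auto simp: closure_of_subtopology Int_absorb1)
  qed (auto simp: eval)
  \<comment> \<open>Both sides are linear in \<open>\<mu>\<close>, so rescaling extends the identity
    beyond the ball; the added 1 covers \<open>\<mu> = 0\<close>.\<close>
  define r where "r = norm \<mu> + 1"
  have r: "r > 0" by (simp add: r_def add_nonneg_pos)
  have "(1 / r) *\<^sub>R \<mu> \<in> cball 0 1" using r by (simp add: r_def field_simps)
  from ball[OF this] have "(1 / r) * \<nu> (\<mu> o\<^sub>L S) = (1 / r) * \<mu> (\<nu> o\<^sub>L T)"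
    by (simp add: blinfun.scaleR_left blinfun.scaleR_right
        bounded_bilinear.scaleR_left[OF bounded_bilinear_blinfun_compose])
  then show ?thesis using r by simp
qed

text \<open>A cycle. The identity turns \<open>\<nu> (\<mu> o\<^sub>L S)\<close> into evaluation of
  \<open>\<mu>\<close> at a fixed point, hence continuity; Banach-Alaoglu then makes the image of
  the bidual ball weakly compact; and this image contains \<open>T\<close> of the unit ball through
  \<open>eval_at\<close>. The identity is kept as a separate condition because it survives
  exchanging \<open>S\<close> and \<open>T\<close>.\<close>

lemma weakly_compact_operator_tfae:
  fixes S :: "'x::real_normed_vector \<Rightarrow>\<^sub>L 'y::real_normed_vector dual" and T :: "'y \<Rightarrow>\<^sub>L 'x dual"
  assumes ST: "\<And>x y. S x y = T y x"
  shows relatively_weakly_compact_iff_symmetric: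
      "relatively_weakly_compact (T ` cball 0 1) \<longleftrightarrow> (\<forall>\<mu> \<nu>. blinfun_apply \<nu> (\<mu> o\<^sub>L S) = blinfun_apply \<mu> (\<nu> o\<^sub>L T))"
    and relatively_weakly_compact_iff_continuous:
      "relatively_weakly_compact (T ` cball 0 1) \<longleftrightarrow>
        continuous_map weak_star_topology weak_topology (\<lambda>\<mu>. \<mu> o\<^sub>L S)"
    and relatively_weakly_compact_iff_compactin:
      "relatively_weakly_compact (T ` cball 0 1) \<longleftrightarrow>
        compactin weak_topology ((\<lambda>\<mu> :: 'y bidual. \<mu> o\<^sub>L S) ` cball 0 1)"
proof -
  let ?rwc = "relatively_weakly_compact (T ` cball 0 1)"
  let ?symm = "\<forall>\<mu> \<nu>. blinfun_apply \<nu> (\<mu> o\<^sub>L S) = blinfun_apply \<mu> (\<nu> o\<^sub>L T)"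
  let ?cont = "continuous_map weak_star_topology weak_topology (\<lambda>\<mu>. \<mu> o\<^sub>L S)"
  let ?comp = "compactin weak_topology ((\<lambda>\<mu> :: 'y bidual. \<mu> o\<^sub>L S) ` cball 0 1)"
  have "?rwc \<Longrightarrow> ?symm"
    using bidual_symmetric_if_relatively_weakly_compact[OF ST] by blast
  moreover have "?symm \<Longrightarrow> ?cont"
    by (simp add: continuous_map_weak_topology_iff strong_operator_topology_continuous_evaluation)
  moreover have "?cont \<Longrightarrow> ?comp"
    using Banach_Alaoglu image_compactin by blast
  moreover have "?comp \<Longrightarrow> ?rwc"
  proof -
    assume comp: ?comp
    have "T y \<in> (\<lambda>\<mu> :: 'y bidual. \<mu> o\<^sub>L S) ` cball 0 1" if "norm y \<le> 1" for y
      using that norm_eval_at_le[of y]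
      by (intro image_eqI[of _ _ "eval_at y"]) (auto intro: blinfun_eqI simp: ST)
    then have "weak_topology closure_of (T ` cball 0 1) \<subseteq> (\<lambda>\<mu>. \<mu> o\<^sub>L S) ` cball 0 1"
      by (intro closure_of_minimal compactin_imp_closedin[OF Hausdorff_weak comp]) auto
    then show ?rwc
      unfolding relatively_weakly_compact_def
      by (rule closed_compactin[OF comp]) simp
  qed
  ultimately show "?rwc \<longleftrightarrow> ?symm" "?rwc \<longleftrightarrow> ?cont" "?rwc \<longleftrightarrow> ?comp"
    by blast+
qed

subsection \<open>Fragmentability\<close>

text \<open>Quantifying over all \<open>\<epsilon>\<close> absorbs the difference between strict
  bounds on extended diameters and non-strict pairwise bounds, which are easier to handle.\<close>

lemma fragmented_family_iff:
  "fragmented_family X d F \<longleftrightarrow>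
    (\<forall>A \<epsilon>. A \<subseteq> topspace X \<and> A \<noteq> {} \<and> \<epsilon> > 0 \<longrightarrow>
      (\<exists>U. openin X U \<and> U \<inter> A \<noteq> {} \<and> (\<forall>x\<in>U \<inter> A. \<forall>y\<in>U \<inter> A. \<forall>f\<in>F. d (f x) (f y) \<le> \<epsilon>)))"
  (is "?L \<longleftrightarrow> ?R")
proof
  assume L: ?L
  show ?R
  proof (intro allI impI)
    fix A and \<epsilon> :: real
    assume A: "A \<subseteq> topspace X \<and> A \<noteq> {} \<and> \<epsilon> > 0"
    obtain U where U: "openin X U" "U \<inter> A \<noteq> {}" "\<And>f. f \<in> F \<Longrightarrow> ediam d (f ` (U \<inter> A)) < ennreal \<epsilon>"
      using L[unfolded fragmented_family_def, rule_format, OF A] by blast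
    have "d (f x) (f y) \<le> \<epsilon>" if "x \<in> U \<inter> A" "y \<in> U \<inter> A" "f \<in> F" for x y f
    proof -
      have "ennreal (d (f x) (f y)) \<le> (SUP v\<in>f ` (U \<inter> A). ennreal (d (f x) v))"
        using that by (intro SUP_upper) auto
      also have "\<dots> \<le> ediam d (f ` (U \<inter> A))"
        unfolding ediam_def using that by (intro SUP_upper) auto
      also have "\<dots> < ennreal \<epsilon>" using U that by blast
      finally show ?thesis using A by (metis ennreal_leI leD nle_le)
    qed
    then show "\<exists>U. openin X U \<and> U \<inter> A \<noteq> {} \<and> (\<forall>x\<in>U \<inter> A. \<forall>y\<in>U \<inter> A. \<forall>f\<in>F. d (f x) (f y) \<le> \<epsilon>)"
      using U by blast
  qed
next
  assume R: ?R
  show ?L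
    unfolding fragmented_family_def
  proof (intro allI impI)
    fix A and \<epsilon> :: real
    assume A: "A \<subseteq> topspace X \<and> A \<noteq> {} \<and> \<epsilon> > 0"
    \<comment> \<open>Pairwise bounds control the diameter only non-strictly; halving
      \<open>\<epsilon>\<close> restores strictness.\<close>
    then have A2: "A \<subseteq> topspace X \<and> A \<noteq> {} \<and> \<epsilon> / 2 > 0" by simp
    obtain U where U: "openin X U" "U \<inter> A \<noteq> {}"
      "\<And>x y f. x \<in> U \<inter> A \<Longrightarrow> y \<in> U \<inter> A \<Longrightarrow> f \<in> F \<Longrightarrow> d (f x) (f y) \<le> \<epsilon> / 2"
      using R[rule_format, OF A2] by blast
    have "ediam d (f ` (U \<inter> A)) < ennreal \<epsilon>" if "f \<in> F" for f
    proof -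
      have "ediam d (f ` (U \<inter> A)) \<le> ennreal (\<epsilon> / 2)"
        unfolding ediam_def using U(3)[OF _ _ that] by (auto intro!: SUP_least ennreal_leI)
      also have "\<dots> < ennreal \<epsilon>" using A by (intro ennreal_lessI) auto
      finally show ?thesis .
    qed
    then show "\<exists>U. openin X U \<and> U \<inter> A \<noteq> {} \<and> (\<forall>f\<in>F. ediam d (f ` (U \<inter> A)) < ennreal \<epsilon>)"
      using U by blast
  qed
qed

lemma fragmented_eq_fragmented_family: "fragmented X d f \<longleftrightarrow> fragmented_family X d {f}"
  by (simp add: fragmented_def fragmented_family_def)

text \<open>Fragmentability sees a family only through its pairwise bounds, so a single map measured
  in norm can be traded for a family of maps whose distances have that norm distance as
  supremum.\<close>

lemma fragmented_family_cong:
  assumes "\<And>x y \<epsilon>. x \<in> topspace X \<Longrightarrow> y \<in> topspace X \<Longrightarrow> \<epsilon> > 0 \<Longrightarrow>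
    (\<forall>f\<in>F. d (f x) (f y) \<le> \<epsilon>) \<longleftrightarrow> (\<forall>g\<in>G. d' (g x) (g y) \<le> \<epsilon>)"
  shows "fragmented_family X d F \<longleftrightarrow> fragmented_family X d' G"
proof -
  have *: "(\<forall>x\<in>U \<inter> A. \<forall>y\<in>U \<inter> A. \<forall>f\<in>F. d (f x) (f y) \<le> \<epsilon>) \<longleftrightarrow>
      (\<forall>x\<in>U \<inter> A. \<forall>y\<in>U \<inter> A. \<forall>g\<in>G. d' (g x) (g y) \<le> \<epsilon>)"
    if "A \<subseteq> topspace X \<and> A \<noteq> {} \<and> \<epsilon> > 0" for U A \<epsilon>
    by (intro ball_cong refl assms) (use that in auto)
  show ?thesis
    unfolding fragmented_family_iff by (intro iff_allI imp_cong ex_cong1 conj_cong refl *)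
qed

text \<open>Zorn's lemma; the complement of \<open>U\<close> is a minimal closed set whose image
  covers \<open>K\<close>. If the union of a chain swallowed the compact fibre over some
  \<open>y\<close> in \<open>K\<close>, finitely many members would, and the largest of them would
  already do so.\<close>

lemma maximal_open_with_full_image:
  assumes X: "compact_space X" and g: "continuous_map X euclidean (g :: 'x \<Rightarrow> 'b::t2_space)"
    and K: "K \<subseteq> g ` topspace X"
  obtains U where "openin X U" "K \<subseteq> g ` (topspace X - U)"
    "\<And>V. openin X V \<Longrightarrow> U \<subset> V \<Longrightarrow> \<not> K \<subseteq> g ` (topspace X - V)"
proof -
  define \<A> where "\<A> = {U. openin X U \<and> K \<subseteq> g ` (topspace X - U)}"
  have "\<exists>M\<in>\<A>. \<forall>V\<in>\<A>. M \<subseteq> V \<longrightarrow> V = M"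
  proof (rule subset_Zorn')
    fix \<C> assume ch: "subset.chain \<A> \<C>"
    then have \<C>: "\<C> \<subseteq> \<A>" by (simp add: subset.chain_def)
    have "y \<in> g ` (topspace X - \<Union>\<C>)" if y: "y \<in> K" for y
    proof (rule ccontr)
      assume not: "y \<notin> g ` (topspace X - \<Union>\<C>)"
      define F where "F = {x \<in> topspace X. g x \<in> {y}}"
      have "compactin X F"
        unfolding F_def using X
        by (intro closedin_compact_space closedin_continuous_map_preimage[OF g]) auto
      moreover have "F \<subseteq> \<Union>\<C>" using not by (auto simp: F_def)
      moreover have "\<And>U. U \<in> \<C> \<Longrightarrow> openin X U" using \<C> by (auto simp: \<A>_def)
      ultimately obtain \<D> where \<D>: "finite \<D>" "\<D> \<subseteq> \<C>" "F \<subseteq> \<Union>\<D>"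
        unfolding compactin_def by metis
      have "F \<noteq> {}" using y K by (auto simp: F_def)
      then have "\<D> \<noteq> {}" using \<D> by auto
      moreover have "subset.chain \<A> \<D>"
        using ch \<D>(2) unfolding subset.chain_def by blast
      ultimately have "\<Union>\<D> \<in> \<D>"
        using \<D>(1) by (intro Union_in_chain)
      then have "\<Union>\<D> \<in> \<A>" using \<D>(2) \<C> by blast
      then have "y \<in> g ` (topspace X - \<Union>\<D>)" using y by (auto simp: \<A>_def)
      then show False using \<D>(3) by (auto simp: F_def)
    qed
    then show "\<Union>\<C> \<in> \<A>"
      using \<C> by (auto simp: \<A>_def)
  qed
  then obtain M where "M \<in> \<A>" "\<And>V. V \<in> \<A> \<Longrightarrow> M \<subseteq> V \<Longrightarrow> V = M" by blast
  then show thesis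
    by (intro that[of M]) (auto simp: \<A>_def)
qed

text \<open>The fragmenting open sets are not preimages under \<open>g\<close>, so no countable base is directly
  available on \<open>X\<close>. Restricting to a minimal closed set mapped onto the bad part \<open>K\<close> of the image
  transfers fragmentability to the second countable image.\<close>

lemma fragmented_imp_countable_cover:
  fixes g :: "'x \<Rightarrow> 'b::{second_countable_topology, t2_space}" and f :: "'x \<Rightarrow> 'm::metric_space"
  assumes X: "compact_space X" and g: "continuous_map X euclidean g"
    and f: "fragmented X dist f"
    and gf: "\<And>x y. x \<in> topspace X \<Longrightarrow> y \<in> topspace X \<Longrightarrow> g x = g y \<Longrightarrow> f x = f y"
    and e: "e > 0"
  obtains E where "countable E" "E \<subseteq> f ` topspace X" "f ` topspace X \<subseteq> (\<Union>m\<in>E. cball m e)"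
proof -
  \<comment> \<open>A set \<open>U\<close> is good if the values of \<open>f\<close> over it lie
    within \<open>e\<close> of a countable set of values. The countably many good basic sets have a
    good union; the claim is that it contains the image of \<open>g\<close>.\<close>
  define cov where "cov U E \<longleftrightarrow> countable E \<and> E \<subseteq> f ` topspace X \<and>
    (\<forall>x\<in>topspace X. g x \<in> U \<longrightarrow> (\<exists>m\<in>E. dist m (f x) \<le> e))" for U E
  obtain \<B> :: "'b set set" where \<B>: "countable \<B>" "topological_basis \<B>"
    using ex_countable_basis by blast
  define \<W> where "\<W> = {B \<in> \<B>. \<exists>E. cov B E}"
  have "\<exists>E. \<forall>B\<in>\<W>. cov B (E B)" by (intro bchoice) (auto simp: \<W>_def)
  then obtain E where E: "\<And>B. B \<in> \<W> \<Longrightarrow> cov B (E B)" by blast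
  have "countable \<W>" using \<B>(1) by (simp add: \<W>_def)
  then have W: "cov (\<Union>\<W>) (\<Union>B\<in>\<W>. E B)"
    using E unfolding cov_def by (auto, blast+)
  have "g ` topspace X \<subseteq> \<Union>\<W>"
  proof (rule ccontr)
    assume not: "\<not> g ` topspace X \<subseteq> \<Union>\<W>"
    define K where "K = g ` topspace X - \<Union>\<W>"
    have "K \<subseteq> g ` topspace X" by (auto simp: K_def)
    from maximal_open_with_full_image[OF X g this]
    obtain U where U: "openin X U" "K \<subseteq> g ` (topspace X - U)"
      and max: "\<And>V. openin X V \<Longrightarrow> U \<subset> V \<Longrightarrow> \<not> K \<subseteq> g ` (topspace X - V)" by blast
    define C where "C = topspace X - U"
    have C: "C \<subseteq> topspace X \<and> C \<noteq> {} \<and> e > 0" using not U(2) e by (auto simp: C_def K_def)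
    obtain O' where O: "openin X O'" "O' \<inter> C \<noteq> {}"
      "\<And>x y. x \<in> O' \<inter> C \<Longrightarrow> y \<in> O' \<inter> C \<Longrightarrow> dist (f x) (f y) \<le> e"
      using f[unfolded fragmented_eq_fragmented_family fragmented_family_iff, rule_format, OF C] by blast
    obtain c where c: "c \<in> O' \<inter> C" using O(2) by blast
    \<comment> \<open>By maximality \<open>C\<close> without \<open>O'\<close> no longer maps onto
      \<open>K\<close>. It misses some \<open>y\<close>, and by compactness a whole neighbourhood
      \<open>B\<close> of \<open>y\<close>, over which \<open>C\<close> therefore lies in
      \<open>O'\<close>.\<close>
    have "U \<subset> U \<union> O'" using c by (auto simp: C_def)
    then obtain y where y: "y \<in> K" "y \<notin> g ` (topspace X - (U \<union> O'))"
      using max[of "U \<union> O'"] U(1) O(1) by auto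
    have "compactin X (topspace X - (U \<union> O'))"
      using X U(1) O(1) by (intro closedin_compact_space closedin_diff) auto
    from image_compactin[OF this g] have "closed (g ` (topspace X - (U \<union> O')))"
      by (simp add: compact_imp_closed compactin_euclidean_iff)
    then have "open (- g ` (topspace X - (U \<union> O')))" by auto
    then obtain B where B: "B \<in> \<B>" "y \<in> B" "B \<subseteq> - g ` (topspace X - (U \<union> O'))"
      using \<B>(2) y(2) by (metis ComplI topological_basisE)
    \<comment> \<open>One new centre suffices: over \<open>B\<close> and outside
      \<open>\<Union>\<W>\<close>, each point has the same value of \<open>f\<close> as some
      \<open>z\<close> in \<open>O' \<inter> C\<close>, since \<open>f\<close> factors through
      \<open>g\<close>.\<close>
    have "cov B (insert (f c) (\<Union>B\<in>\<W>. E B))"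
      unfolding cov_def
    proof (intro conjI ballI impI)
      fix x assume x: "x \<in> topspace X" "g x \<in> B"
      show "\<exists>m\<in>insert (f c) (\<Union>B\<in>\<W>. E B). dist m (f x) \<le> e"
      proof (cases "g x \<in> \<Union>\<W>")
        case True
        then show ?thesis using W x(1) unfolding cov_def by blast
      next
        case False
        then obtain z where z: "z \<in> C" "g x = g z"
          using U(2) x(1) by (auto simp: K_def C_def)
        then have "z \<in> O' \<inter> C" using B(3) x(2) by (auto simp: C_def)
        moreover have "f x = f z" using gf[OF x(1) _ z(2)] z(1) by (simp add: C_def)
        ultimately show ?thesis using O(3) c by auto
      qed
    qed (use W c in \<open>auto simp: cov_def C_def\<close>)
    then have "B \<in> \<W>" using B(1) by (auto simp: \<W>_def)
    then show False using y(1) B(2) by (auto simp: K_def)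
  qed
  then show thesis
    using W unfolding cov_def by (intro that[of "\<Union>B\<in>\<W>. E B"]) (auto, blast)
qed

text \<open>The centres of the countable covers for all radii \<open>inverse (Suc n)\<close>
  together are dense in the image.\<close>

lemma fragmented_imp_separable_image:
  fixes g :: "'x \<Rightarrow> 'b::{second_countable_topology, t2_space}" and f :: "'x \<Rightarrow> 'm::metric_space"
  assumes "compact_space X" "continuous_map X euclidean g" "fragmented X dist f"
    and "\<And>x y. x \<in> topspace X \<Longrightarrow> y \<in> topspace X \<Longrightarrow> g x = g y \<Longrightarrow> f x = f y"
  shows "separable_space (top_of_set (f ` topspace X))"
proof -
  have "\<exists>E. countable E \<and> E \<subseteq> f ` topspace X \<and> f ` topspace X \<subseteq> (\<Union>m\<in>E. cball m (inverse (Suc n)))" for n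
    using fragmented_imp_countable_cover[OF assms, of "inverse (Suc n)"] by fastforce
  then obtain E where E: "\<And>n. countable (E n)" "\<And>n. E n \<subseteq> f ` topspace X"
    "\<And>n. f ` topspace X \<subseteq> (\<Union>m\<in>E n. cball m (inverse (Suc n)))"
    by metis
  have "f ` topspace X \<subseteq> closure (\<Union>n. E n)"
  proof
    fix z assume z: "z \<in> f ` topspace X"
    show "z \<in> closure (\<Union>n. E n)"
      unfolding closure_approachable
    proof (intro allI impI)
      fix r :: real assume "r > 0"
      then obtain n where n: "inverse (Suc n) < r" using reals_Archimedean by blast
      obtain m where "m \<in> E n" "dist m z \<le> inverse (Suc n)"
        using E(3)[of n] z by (auto simp: subset_eq)
      then show "\<exists>y\<in>\<Union>n. E n. dist y z < r" using n by (auto intro!: bexI[of _ m])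
    qed
  qed
  then show ?thesis
    unfolding separable_space_def using E
    by (intro exI[of _ "\<Union>n. E n"]) (auto simp: closure_of_subtopology Int_absorb1 UN_least)
qed

text \<open>Balls around a countable dense set of values pull back to countably many sets covering
  the space, and by Baire's theorem one of them has interior. The last hypothesis, a semicontinuity
  of distances in place of continuity of \<open>f\<close>, makes these sets closed.\<close>

lemma separable_image_imp_fragmented:
  fixes f :: "'x \<Rightarrow> 'm::metric_space"
  assumes X: "compact_space X" "Hausdorff_space X"
    and sep: "separable_space (top_of_set (f ` topspace X))"
    and closed: "\<And>m r. closedin X {x \<in> topspace X. dist m (f x) \<le> r}"
  shows "fragmented X dist f"
  unfolding fragmented_eq_fragmented_family fragmented_family_iff
proof (intro allI impI)
  fix A and \<epsilon> :: real
  assume A: "A \<subseteq> topspace X \<and> A \<noteq> {} \<and> \<epsilon> > 0"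
  obtain D where D: "countable D" "D \<subseteq> f ` topspace X" "top_of_set (f ` topspace X) closure_of D = f ` topspace X"
    using sep by (auto simp: separable_space_def)
  then have D': "f ` topspace X \<subseteq> closure D"
    by (auto simp: closure_of_subtopology Int_absorb1)
  \<comment> \<open>Passing to the closure provides a compact Hausdorff space for Baire's theorem;
    \<open>A\<close> is dense in it, so an open set meeting \<open>C\<close> also meets
    \<open>A\<close>.\<close>
  define C where "C = X closure_of A"
  define Y where "Y = subtopology X C"
  have C: "closedin X C" "A \<subseteq> C" using A by (auto simp: C_def closure_of_subset)
  then have tY: "topspace Y = C" using closedin_subset by (auto simp: Y_def)
  have Y: "compact_space Y" "Hausdorff_space Y"
    using X C unfolding Y_def
    by (auto intro: compact_space_subtopology closedin_compact_space Hausdorff_space_subtopology)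
  define P where "P m = {x \<in> C. dist m (f x) \<le> \<epsilon> / 2}" for m
  have P: "closedin Y (P m)" for m
  proof -
    have "closedin Y ({x \<in> topspace X. dist m (f x) \<le> \<epsilon> / 2} \<inter> C)"
      unfolding Y_def closedin_subtopology using closed by blast
    also have "{x \<in> topspace X. dist m (f x) \<le> \<epsilon> / 2} \<inter> C = P m"
      using closedin_subset[OF C(1)] by (auto simp: P_def)
    finally show ?thesis .
  qed
  have UP: "\<Union>(P ` D) = C"
  proof -
    have "\<exists>m\<in>D. dist m (f x) \<le> \<epsilon> / 2" if "x \<in> C" for x
    proof -
      have "f x \<in> closure D" using that D' closedin_subset[OF C(1)] by blast
      moreover have "\<epsilon> / 2 > 0" using A by simp
      ultimately obtain m where "m \<in> D" "dist m (f x) < \<epsilon> / 2" unfolding closure_approachable by meson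
      then show ?thesis by (auto intro!: bexI[of _ m])
    qed
    then show ?thesis by (auto simp: P_def)
  qed
  have "Y interior_of \<Union>(P ` D) \<noteq> {}"
    using A C(2) interior_of_topspace[of Y] unfolding UP tY by blast
  then obtain m where m: "Y interior_of P m \<noteq> {}"
    using Baire_category_alt[of Y "P ` D"] Y D(1) P
    by (metis compact_Hausdorff_imp_regular_space compact_imp_locally_compact_space countable_image imageE)
  then obtain V where V: "openin X V" "Y interior_of P m = V \<inter> C"
    by (metis Y_def openin_interior_of openin_subtopology)
  have VC: "V \<inter> C \<subseteq> P m" using V(2) interior_of_subset by metis
  obtain x where "x \<in> V" "x \<in> X closure_of A" using m V(2) by (auto simp: C_def)
  then have "V \<inter> A \<noteq> {}"
    using V(1) unfolding in_closure_of by blast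
  moreover have "dist (f x) (f y) \<le> \<epsilon>" if "x \<in> V \<inter> A" "y \<in> V \<inter> A" for x y
  proof -
    have "dist m (f x) \<le> \<epsilon> / 2" "dist m (f y) \<le> \<epsilon> / 2"
      using VC that C(2) by (auto simp: P_def)
    then show ?thesis using dist_triangle3[of "f x" "f y" m] by linarith
  qed
  ultimately show "\<exists>U. openin X U \<and> U \<inter> A \<noteq> {} \<and>
      (\<forall>x\<in>U \<inter> A. \<forall>y\<in>U \<inter> A. \<forall>f\<in>{f}. dist (f x) (f y) \<le> \<epsilon>)"
    using V(1) by blast
qed

section \<open>Norms as suprema over unit balls, and fragmentability of the adjoint\<close>

lemma dual_norm_le_iff:
  fixes f :: "'v::real_normed_vector dual"
  assumes "r \<ge> 0"
  shows "norm f \<le> r \<longleftrightarrow> (\<forall>x\<in>cball 0 1. \<bar>f x\<bar> \<le> r)"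
proof (intro iffI ballI)
  fix x :: 'v assume "norm f \<le> r" "x \<in> cball 0 1"
  then show "\<bar>f x\<bar> \<le> r"
    using norm_blinfun[of f x] mult_mono[of "norm f" r "norm x" 1] assms by simp
next
  assume f: "\<forall>x\<in>cball 0 1. \<bar>f x\<bar> \<le> r"
  show "norm f \<le> r"
  proof (rule norm_blinfun_bound[OF assms])
    fix x :: 'v
    show "norm (f x) \<le> r * norm x"
    proof (cases "x = 0")
      case False
      then have "\<bar>f (x /\<^sub>R norm x)\<bar> \<le> r" using f by simp
      then show ?thesis using False by (simp add: blinfun.scaleR_right abs_mult field_simps)
    qed (simp add: blinfun.zero_right)
  qed
qed

text \<open>Since \<open>f\<close> is itself a functional, the points \<open>eval_at x\<close>
  already recover its norm, and the rest of the bidual ball cannot exceed it.\<close>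

lemma bidual_ball_le_iff:
  fixes f :: "'v::real_normed_vector dual"
  assumes "r \<ge> 0"
  shows "(\<forall>\<nu>\<in>cball 0 1 :: 'v bidual set. \<bar>\<nu> f\<bar> \<le> r) \<longleftrightarrow> norm f \<le> r"
proof
  assume *: "\<forall>\<nu>\<in>cball 0 1 :: 'v bidual set. \<bar>\<nu> f\<bar> \<le> r"
  have "\<bar>f x\<bar> \<le> r" if "norm x \<le> 1" for x
    using *[rule_format, of "eval_at x"] that norm_eval_at_le[of x] by simp
  then show "norm f \<le> r" by (simp add: dual_norm_le_iff[OF assms])
next
  assume f: "norm f \<le> r"
  show "\<forall>\<nu>\<in>cball 0 1 :: 'v bidual set. \<bar>\<nu> f\<bar> \<le> r"
  proof
    fix \<nu> :: "'v bidual" assume "\<nu> \<in> cball 0 1"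
    then show "\<bar>\<nu> f\<bar> \<le> r"
      using norm_blinfun[of \<nu> f] mult_right_mono[of "norm \<nu>" 1 "norm f"] f by simp
  qed
qed

text \<open>The supremum of \<open>\<bar>\<mu> (S x) - \<mu>' (S x)\<bar>\<close> over
  \<open>x\<close> in the unit ball is the norm distance of \<open>\<mu> o\<^sub>L S\<close> and
  \<open>\<mu>' o\<^sub>L S\<close>.\<close>

lemma asplund_iff_fragmented_adjoint:
  fixes S :: "'x::real_normed_vector \<Rightarrow>\<^sub>L 'y::real_normed_vector dual"
  shows "asplund_subset (S ` cball 0 1) \<longleftrightarrow>
    fragmented (subtopology weak_star_topology (cball 0 1)) dist (\<lambda>\<mu>. \<mu> o\<^sub>L S)"
proof -
  have "bounded (S ` cball 0 1)"
    by (intro bounded_linear_image bounded_cball blinfun.bounded_linear_right)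
  moreover have "(\<forall>f\<in>(\<lambda>x (f :: 'y bidual). f x) ` S ` cball 0 1. dist (f \<mu>) (f \<mu>') \<le> \<epsilon>) \<longleftrightarrow>
      (\<forall>g\<in>{\<lambda>\<mu>. \<mu> o\<^sub>L S}. dist (g \<mu>) (g \<mu>') \<le> \<epsilon>)" if "\<epsilon> > 0" for \<mu> \<mu>' :: "'y bidual" and \<epsilon>
    using dual_norm_le_iff[of \<epsilon> "(\<mu> o\<^sub>L S) - (\<mu>' o\<^sub>L S)"] that
    by (simp add: dist_norm blinfun.diff_left)
  ultimately show ?thesis
    unfolding asplund_subset_def fragmented_eq_fragmented_family
    by (simp add: fragmented_family_cong)
qed

text \<open>Forward, the values \<open>\<mu> (S (d n))\<close> on a dense sequence map the ball
  continuously into the second countable space of real sequences and determine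
  \<open>\<mu> o\<^sub>L S\<close>. Backward, the Baire argument applies because norm balls pull
  back to weak-star closed sets.\<close>

lemma separable_iff_fragmented_adjoint:
  fixes S :: "'x::real_normed_vector \<Rightarrow>\<^sub>L 'y::real_normed_vector dual"
  assumes "separable_space (euclidean :: 'x topology)"
  shows "fragmented (subtopology weak_star_topology (cball 0 1)) dist (\<lambda>\<mu>. \<mu> o\<^sub>L S) \<longleftrightarrow>
    separable_space (top_of_set ((\<lambda>\<mu> :: 'y bidual. \<mu> o\<^sub>L S) ` cball 0 1))"
proof
  let ?B = "subtopology weak_star_topology (cball 0 1 :: 'y bidual set)"
  let ?f = "\<lambda>\<mu> :: 'y bidual. \<mu> o\<^sub>L S"
  assume fr: "fragmented ?B dist ?f"
  obtain D :: "'x set" where D: "countable D" "closure D = UNIV"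
    using assms by (auto simp: separable_space_def)
  then have "D \<noteq> {}" by auto
  define d where "d = from_nat_into D"
  have d: "range d = D" using D(1) \<open>D \<noteq> {}\<close> by (simp add: d_def range_from_nat_into)
  define g :: "'y bidual \<Rightarrow> nat \<Rightarrow> real" where "g \<mu> n = \<mu> (S (d n))" for \<mu> n
  have g: "continuous_map ?B euclidean g"
    unfolding euclidean_product_topology[symmetric] continuous_map_componentwise_UNIV g_def
    by (intro allI continuous_map_from_subtopology strong_operator_topology_continuous_evaluation)
  have gf: "\<mu> o\<^sub>L S = \<mu>' o\<^sub>L S" if "g \<mu> = g \<mu>'" for \<mu> \<mu>'
  proof (rule blinfun_eqI)
    fix x
    have "closed {x. (\<mu> o\<^sub>L S) x = (\<mu>' o\<^sub>L S) x}"
      by (intro closed_Collect_eq linear_continuous_on blinfun.bounded_linear_right)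
    moreover have "D \<subseteq> {x. (\<mu> o\<^sub>L S) x = (\<mu>' o\<^sub>L S) x}"
      using that by (auto simp: d[symmetric] g_def fun_eq_iff)
    ultimately have "closure D \<subseteq> {x. (\<mu> o\<^sub>L S) x = (\<mu>' o\<^sub>L S) x}" by (intro closure_minimal)
    then show "(\<mu> o\<^sub>L S) x = (\<mu>' o\<^sub>L S) x" using D(2) by auto
  qed
  have "separable_space (top_of_set (?f ` topspace ?B))"
    by (rule fragmented_imp_separable_image[OF compact_space_weak_star_ball g fr]) (rule gf)
  then show "separable_space (top_of_set (?f ` cball 0 1))" by simp
next
  let ?B = "subtopology weak_star_topology (cball 0 1 :: 'y bidual set)"
  let ?f = "\<lambda>\<mu> :: 'y bidual. \<mu> o\<^sub>L S"
  assume sep: "separable_space (top_of_set (?f ` cball 0 1))"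
  show "fragmented ?B dist ?f"
  proof (rule separable_image_imp_fragmented)
    fix m and r :: real
    show "closedin ?B {\<mu> \<in> topspace ?B. dist m (?f \<mu>) \<le> r}"
    proof (cases "r \<ge> 0")
      case True
      \<comment> \<open>A norm ball of the dual is cut out by conditions at single vectors
        \<open>x\<close>, each weak-star closed.\<close>
      have "closedin ?B {\<mu> \<in> topspace ?B. \<mu> (S x) \<in> cball (m x) r}" for x
        by (intro closedin_continuous_map_preimage[where Y = euclidean] continuous_map_from_subtopology
            strong_operator_topology_continuous_evaluation) simp
      then have "closedin ?B (topspace ?B \<inter> (\<Inter>x\<in>cball 0 1. {\<mu> \<in> topspace ?B. \<mu> (S x) \<in> cball (m x) r}))"
        by (intro closedin_Int closedin_topspace closedin_Inter) auto
      also have "topspace ?B \<inter> (\<Inter>x\<in>cball 0 1. {\<mu> \<in> topspace ?B. \<mu> (S x) \<in> cball (m x) r}) =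
          {\<mu> \<in> topspace ?B. dist m (?f \<mu>) \<le> r}"
        unfolding dist_norm dual_norm_le_iff[OF True]
        by (auto simp: blinfun.diff_left dist_real_def)
      finally show ?thesis .
    next
      case False
      then have "{\<mu> \<in> topspace ?B. dist m (?f \<mu>) \<le> r} = {}"
        using order_trans[OF zero_le_dist] by blast
      then show ?thesis by (simp only: closedin_empty)
    qed
  qed (use sep in \<open>auto simp: compact_space_weak_star_ball Hausdorff_space_subtopology Hausdorff_weak_star\<close>)
qed

subsection \<open>Independent sequences and \<open>\<ell>\<^sup>1\<close>-sequences\<close>

text \<open>As \<open>a\<close> and \<open>b\<close> may have the same sign, two functionals are
  taken, for the sign pattern of \<open>t\<close> and for its reverse. Their difference has at each
  \<open>x i\<close> the sign of \<open>t i\<close> and size at least \<open>b - a\<close>; its norm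
  is at most 2, which gives the lower constant \<open>(b - a) / 2\<close>.\<close>

lemma independent_imp_l1_sequence:
  fixes x :: "nat \<Rightarrow> 'v::real_normed_vector"
  assumes ind: "independent_on (cball 0 1 :: 'v dual set) (\<lambda>n f. f (x n))" and bdd: "bounded (range x)"
  shows "l1_sequence x"
proof -
  have "\<exists>a b. a < b \<and> (\<forall>N M. finite N \<and> finite M \<and> N \<inter> M = {} \<longrightarrow>
      (\<exists>f\<in>cball 0 1 :: 'v dual set. (\<forall>n\<in>N. f (x n) \<le> a) \<and> (\<forall>m\<in>M. f (x m) \<ge> b)))"
    using ind unfolding independent_on_def by (rule conjunct2)
  then obtain a b where ab: "a < b" and ind: "\<forall>N M. finite N \<and> finite M \<and> N \<inter> M = {} \<longrightarrow>
      (\<exists>f\<in>cball 0 1 :: 'v dual set. (\<forall>n\<in>N. f (x n) \<le> a) \<and> (\<forall>m\<in>M. f (x m) \<ge> b))"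
    by (elim exE conjE)
  obtain K where K: "K > 0" "\<And>n. norm (x n) \<le> K"
    using bdd by (auto simp: bounded_pos)
  show ?thesis
    unfolding l1_sequence_def
  proof (intro exI conjI allI)
    fix n and t :: "nat \<Rightarrow> real"
    let ?N = "{i. i < n \<and> t i < 0}" and ?M = "{i. i < n \<and> t i \<ge> 0}"
    have NM: "finite ?N \<and> finite ?M \<and> ?N \<inter> ?M = {}" "finite ?M \<and> finite ?N \<and> ?M \<inter> ?N = {}"
      by auto
    obtain f :: "'v dual" where f: "norm f \<le> 1" "\<And>i. i \<in> ?N \<Longrightarrow> f (x i) \<le> a" "\<And>i. i \<in> ?M \<Longrightarrow> f (x i) \<ge> b"
      using ind[rule_format, OF NM(1)] by (auto simp: dist_norm)
    obtain g :: "'v dual" where g: "norm g \<le> 1" "\<And>i. i \<in> ?M \<Longrightarrow> g (x i) \<le> a" "\<And>i. i \<in> ?N \<Longrightarrow> g (x i) \<ge> b"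
      using ind[rule_format, OF NM(2)] by (auto simp: dist_norm)
    have "(b - a) * \<bar>t i\<bar> \<le> t i * (f - g) (x i)" if "i < n" for i
    proof (cases "t i < 0")
      case True
      then show ?thesis
        using f(2)[of i] g(3)[of i] that mult_left_mono_neg[of "f (x i) - g (x i)" "a - b" "t i"]
        by (simp add: blinfun.diff_left algebra_simps)
    next
      case False
      then show ?thesis
        using f(3)[of i] g(2)[of i] that mult_left_mono[of "b - a" "f (x i) - g (x i)" "t i"]
        by (simp add: blinfun.diff_left algebra_simps)
    qed
    then have "(b - a) * (\<Sum>i<n. \<bar>t i\<bar>) \<le> (\<Sum>i<n. t i * (f - g) (x i))"
      unfolding sum_distrib_left by (intro sum_mono) auto
    also have "\<dots> = (f - g) (\<Sum>i<n. t i *\<^sub>R x i)"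
      by (simp add: blinfun.sum_right blinfun.scaleR_right)
    also have "\<dots> \<le> norm (f - g) * norm (\<Sum>i<n. t i *\<^sub>R x i)"
      using norm_blinfun[of "f - g"] by (metis abs_le_D1 real_norm_def)
    also have "\<dots> \<le> 2 * norm (\<Sum>i<n. t i *\<^sub>R x i)"
      using norm_triangle_ineq4[of f g] f(1) g(1) by (intro mult_right_mono) auto
    finally show "(b - a) / 2 * (\<Sum>i<n. \<bar>t i\<bar>) \<le> norm (\<Sum>i<n. t i *\<^sub>R x i)" by simp
    show "norm (\<Sum>i<n. t i *\<^sub>R x i) \<le> K * (\<Sum>i<n. \<bar>t i\<bar>)"
      unfolding sum_distrib_left
      by (rule sum_norm_le) (use K(2) in \<open>simp add: mult.commute[of K] mult_left_mono\<close>)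
  qed (use ab K(1) in auto)
qed

text \<open>The lower estimate is exactly Helly's hypothesis for prescribed values \<open>c\<close>
  and \<open>- c\<close>, so the witnesses can be taken of the form
  \<open>eval_at y\<close>.\<close>

lemma l1_sequence_imp_independent:
  fixes h :: "nat \<Rightarrow> 'v::real_normed_vector dual"
  assumes "l1_sequence h"
  shows "independent_on (cball 0 1 :: 'v bidual set) (\<lambda>n \<mu>. \<mu> (h n))"
proof -
  obtain c K where cK: "c > 0" "K > 0"
    and lower: "\<And>n t. c * (\<Sum>i<n. \<bar>t i\<bar>) \<le> norm (\<Sum>i<n. t i *\<^sub>R h i)"
    and upper: "\<And>n t. norm (\<Sum>i<n. t i *\<^sub>R h i) \<le> K * (\<Sum>i<n. \<bar>t i\<bar>)"
    using assms unfolding l1_sequence_def by blast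
  have hK: "norm (h n) \<le> K" for n
  proof -
    have "(\<Sum>i<Suc n. (if i = n then 1 else 0) *\<^sub>R h i) = h n"
      "(\<Sum>i<Suc n. \<bar>if i = n then 1 else 0 :: real\<bar>) = 1" by simp_all
    then show ?thesis using upper[where n = "Suc n" and t = "\<lambda>i. if i = n then 1 else 0"] by simp
  qed
  have bound: "\<bar>\<mu> (h n)\<bar> \<le> K" if "\<mu> \<in> cball 0 1" for \<mu> :: "'v bidual" and n
    using bidual_ball_le_iff[of K "h n"] hK cK that by auto
  have sep: "\<exists>\<mu>\<in>cball 0 1 :: 'v bidual set. (\<forall>n\<in>N. \<mu> (h n) \<le> - c / 2) \<and> (\<forall>m\<in>M. \<mu> (h m) \<ge> c / 2)"
    if NM: "finite N" "finite M" "N \<inter> M = {}" for N M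
  proof -
    obtain k where k: "N \<union> M \<subseteq> {..<k}"
      using NM finite_nat_iff_bounded[of "N \<union> M"] by auto
    \<comment> \<open>Indices below \<open>k\<close> outside \<open>N\<close> and \<open>M\<close>
      also get the value \<open>c\<close>, so that every \<open>s i\<close> has absolute value
      \<open>c\<close>.\<close>
    define s where "s i = (if i \<in> N then - c else c)" for i
    have "\<bar>\<Sum>i<k. t i * s i\<bar> \<le> norm (\<Sum>i<k. t i *\<^sub>R h i)" for t
    proof -
      have "\<bar>\<Sum>i<k. t i * s i\<bar> \<le> (\<Sum>i<k. \<bar>t i * s i\<bar>)" by (rule sum_abs)
      also have "\<dots> = c * (\<Sum>i<k. \<bar>t i\<bar>)"
        unfolding sum_distrib_left using cK by (intro sum.cong) (auto simp: s_def abs_mult)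
      finally show ?thesis using lower[where n = k and t = t] by linarith
    qed
    \<comment> \<open>An error below \<open>c / 2\<close> keeps the values beyond the thresholds
      \<open>- c / 2\<close> and \<open>c / 2\<close>.\<close>
    from Helly[OF finite_lessThan this, of "c / 2"] cK
    obtain y where y: "y \<in> cball 0 1" "\<And>i. i < k \<Longrightarrow> \<bar>h i y - s i\<bar> < c / 2" by auto
    show ?thesis
    proof (intro bexI[of _ "eval_at y"] conjI ballI)
      show "eval_at y \<in> cball 0 1" using y(1) norm_eval_at_le[of y] by simp
      show "eval_at y (h n) \<le> - c / 2" if "n \<in> N" for n
        using y(2)[of n] k that by (auto simp: s_def abs_if split: if_splits)
      show "eval_at y (h m) \<ge> c / 2" if "m \<in> M" for m
      proof -
        have "m < k" "m \<notin> N" using k that NM by auto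
        then show ?thesis using y(2)[of m] by (auto simp: s_def abs_if split: if_splits)
      qed
    qed
  qed
  show ?thesis
    unfolding independent_on_def
  proof
    show "\<exists>K. \<forall>n. \<forall>\<mu>\<in>cball 0 1 :: 'v bidual set. \<bar>\<mu> (h n)\<bar> \<le> K"
      using bound by (intro exI[of _ K]) simp
  qed (rule exI[of _ "- c / 2"], rule exI[of _ "c / 2"], use cK sep in simp)
qed

text \<open>Independence of the vectors \<open>x n\<close> over the image of the adjoint is
  independence of \<open>S (x n)\<close> over the bidual ball, which for bounded sequences in a dual
  means being an \<open>l1_sequence\<close>.\<close>

lemma tame_iff_co_tame_adjoint:
  fixes S :: "'x::real_normed_vector \<Rightarrow>\<^sub>L 'y::real_normed_vector dual"
  shows "tame_subset (S ` cball 0 1) \<longleftrightarrow> co_tame ((\<lambda>\<mu>. \<mu> o\<^sub>L S) ` cball 0 1)"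
proof -
  have bdd: "bounded (S ` cball 0 1)"
    by (intro bounded_linear_image bounded_cball blinfun.bounded_linear_right)
  have "compactin weak_star_topology ((\<lambda>\<mu>. \<mu> o\<^sub>L S) ` cball 0 1)"
    by (rule image_compactin[OF Banach_Alaoglu continuous_map_weak_star_adjoint])
  moreover have "l1_sequence (\<lambda>n. S (x n)) \<longleftrightarrow>
      independent_on ((\<lambda>\<mu>. \<mu> o\<^sub>L S) ` cball 0 1) (\<lambda>n f. f (x n))"
    if "range x \<subseteq> cball 0 1" for x
  proof -
    have "bounded (range (\<lambda>n. S (x n)))"
      by (rule bounded_subset[OF bdd]) (use that in auto)
    then have "l1_sequence (\<lambda>n. S (x n)) \<longleftrightarrow>
        independent_on (cball 0 1 :: 'y bidual set) (\<lambda>n \<mu>. \<mu> (S (x n)))"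
      using l1_sequence_imp_independent[of "\<lambda>n. S (x n)"] independent_imp_l1_sequence[of "\<lambda>n. S (x n)"]
      by argo
    also have "\<dots> \<longleftrightarrow> independent_on ((\<lambda>\<mu>. \<mu> o\<^sub>L S) ` cball 0 1) (\<lambda>n f. f (x n))"
      by (simp add: independent_on_def)
    finally show ?thesis .
  qed
  moreover have "(\<exists>h. range h \<subseteq> S ` cball 0 1 \<and> l1_sequence h) \<longleftrightarrow>
      (\<exists>x. range x \<subseteq> cball 0 1 \<and> l1_sequence (\<lambda>n. S (x n)))"
  proof
    assume "\<exists>h. range h \<subseteq> S ` cball 0 1 \<and> l1_sequence h"
    then obtain h where h: "range h \<subseteq> S ` cball 0 1" "l1_sequence h" by blast
    then have "\<forall>n. \<exists>y. y \<in> cball 0 1 \<and> h n = S y" by blast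
    then obtain x where x: "\<And>n. x n \<in> cball 0 1" "\<And>n. h n = S (x n)" by metis
    then have "h = (\<lambda>n. S (x n))" by auto
    then show "\<exists>x. range x \<subseteq> cball 0 1 \<and> l1_sequence (\<lambda>n. S (x n))"
      using h(2) x(1) by (intro exI[of _ x]) auto
  next
    assume "\<exists>x. range x \<subseteq> cball 0 1 \<and> l1_sequence (\<lambda>n. S (x n))"
    then obtain x where "range x \<subseteq> cball 0 1" "l1_sequence (\<lambda>n. S (x n))" by (elim exE conjE)
    then show "\<exists>h. range h \<subseteq> S ` cball 0 1 \<and> l1_sequence h"
      by (intro exI[of _ "\<lambda>n. S (x n)"]) auto
  qed
  ultimately show ?thesis
    unfolding tame_subset_def co_tame_def using bdd by blast
qed

subsection \<open>Almost periodic, Asplund and tame functionals\<close>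

theorem theorem4p10:
  fixes \<phi> :: "'a::{real_normed_algebra, banach} dual"
  shows "((weakly_almost_periodic \<phi> \<longleftrightarrow> relatively_weakly_compact (act_right \<phi> ` cball 0 1)) \<and>
      (weakly_almost_periodic \<phi> \<longleftrightarrow>
        continuous_map weak_star_topology weak_topology (\<lambda>\<mu>. act_bidual \<mu> \<phi>)) \<and>
      (weakly_almost_periodic \<phi> \<longleftrightarrow>
        (\<forall>\<nu>\<in>cball 0 1. continuous_map weak_star_topology
          (pseudometric_topology (rho_dist \<phi>)) (\<lambda>\<mu>. arens \<nu> \<mu>))) \<and>
      (weakly_almost_periodic \<phi> \<longleftrightarrow>
        compactin weak_topology ((\<lambda>\<mu>. act_bidual \<mu> \<phi>) ` cball 0 1)))
    \<and> ((right_asplund \<phi> \<longleftrightarrow> asplund_subset (act_right \<phi> ` cball 0 1)) \<and>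
      (right_asplund \<phi> \<longleftrightarrow>
        fragmented (subtopology weak_star_topology (cball 0 1)) dist (\<lambda>\<mu>. act_bidual \<mu> \<phi>)) \<and>
      (right_asplund \<phi> \<longleftrightarrow>
        fragmented_family (subtopology weak_star_topology (cball 0 1)) (rho_dist \<phi>)
          ((\<lambda>\<nu> \<mu>. arens \<nu> \<mu>) ` cball 0 1)) \<and>
      (separable_space (euclidean :: 'a topology) \<longrightarrow>
        (right_asplund \<phi> \<longleftrightarrow>
          separable_space (top_of_set ((\<lambda>\<mu>. act_bidual \<mu> \<phi>) ` cball 0 1)))))
    \<and> ((right_tame \<phi> \<longleftrightarrow> tame_subset (act_right \<phi> ` cball 0 1)) \<and>
      (right_tame \<phi> \<longleftrightarrow> co_tame ((\<lambda>\<mu>. act_bidual \<mu> \<phi>) ` cball 0 1)))"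
proof -
  \<comment> \<open>The orbit maps of \<open>\<phi>\<close> as bounded operators;
    \<open>S x y\<close> and \<open>T y x\<close> are both \<open>\<phi> (x * y)\<close>.\<close>
  define S where "S = Blinfun (act_right \<phi>)"
  define T where "T = Blinfun (\<lambda>a. act_left a \<phi>)"
  have S [simp]: "S a = act_right \<phi> a" for a
    unfolding S_def
    by (simp add: bounded_linear_Blinfun_apply bounded_bilinear.bounded_linear_right[OF bounded_bilinear_act_right])
  have "bounded_linear (\<lambda>a. act_left a \<phi>)"
  proof (rule bounded_linear_intro[where K = "norm \<phi>"])
    fix a
    have "norm (\<phi> (b * a)) \<le> norm a * norm \<phi> * norm b" for b
      using norm_blinfun[of \<phi> "b * a"] mult_left_mono[OF norm_mult_ineq[of b a], of "norm \<phi>"]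
      by (simp add: algebra_simps)
    then show "norm (act_left a \<phi>) \<le> norm a * norm \<phi>"
      by (intro norm_blinfun_bound) auto
  qed (auto intro!: blinfun_eqI simp: blinfun.bilinear_simps algebra_simps)
  then have T [simp]: "T a = act_left a \<phi>" for a
    by (simp add: T_def bounded_linear_Blinfun_apply)
  have ST: "S x y = T y x" for x y by simp
  have ad: "act_bidual \<mu> \<phi> = \<mu> o\<^sub>L S" for \<mu>
    by (rule blinfun_eqI) simp
  have wap: "weakly_almost_periodic \<phi> \<longleftrightarrow> relatively_weakly_compact (T ` cball 0 1)"
    by (simp add: weakly_almost_periodic_def)
  have A2: "weakly_almost_periodic \<phi> \<longleftrightarrow> relatively_weakly_compact (act_right \<phi> ` cball 0 1)"
  proof -
    \<comment> \<open>Each side is equivalent to the bidual identity, with the roles of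
      \<open>S\<close> and \<open>T\<close> exchanged.\<close>
    have "relatively_weakly_compact (T ` cball 0 1) \<longleftrightarrow> relatively_weakly_compact (S ` cball 0 1)"
      unfolding relatively_weakly_compact_iff_symmetric[of S T, OF ST]
        relatively_weakly_compact_iff_symmetric[of T S, OF ST[symmetric]] by metis
    then show ?thesis by (simp add: wap)
  qed
  have A3: "weakly_almost_periodic \<phi> \<longleftrightarrow>
      continuous_map weak_star_topology weak_topology (\<lambda>\<mu>. act_bidual \<mu> \<phi>)"
    unfolding wap ad by (rule relatively_weakly_compact_iff_continuous[OF ST])
  \<comment> \<open>Both sides test the functions \<open>\<nu> (act_bidual \<mu> \<phi>)\<close> of
    \<open>\<mu>\<close>, the right one for \<open>\<nu>\<close> in the ball only; rescaling
    \<open>\<nu>\<close> gives the others.\<close>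
  have A4: "continuous_map weak_star_topology weak_topology (\<lambda>\<mu>. act_bidual \<mu> \<phi>) \<longleftrightarrow>
      (\<forall>\<nu>\<in>cball 0 1. continuous_map weak_star_topology
          (pseudometric_topology (rho_dist \<phi>)) (\<lambda>\<mu>. arens \<nu> \<mu>))"
    unfolding continuous_map_weak_topology_iff continuous_map_pseudometric_topology_rho_dist_iff arens_apply
  proof (intro iffI ballI allI)
    fix \<nu> :: "'a bidual"
    assume ball: "\<forall>\<nu>\<in>(cball 0 1 :: 'a bidual set). continuous_map weak_star_topology euclidean
        (\<lambda>\<mu>. blinfun_apply \<nu> (act_bidual \<mu> \<phi>))"
    define r where "r = norm \<nu> + 1"
    have r: "r > 0" by (simp add: r_def add_nonneg_pos)
    have "(1 / r) *\<^sub>R \<nu> \<in> cball 0 1" using r by (simp add: r_def field_simps)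
    with ball have "continuous_map weak_star_topology euclidean 
        (\<lambda>\<mu>. r * blinfun_apply ((1 / r) *\<^sub>R \<nu>) (act_bidual \<mu> \<phi>))"
      by (intro continuous_map_real_mult_left) blast
    then show "continuous_map weak_star_topology euclidean (\<lambda>\<mu>. \<nu> (act_bidual \<mu> \<phi>))"
      using r by (simp add: blinfun.scaleR_left)
  qed blast
  have A5: "weakly_almost_periodic \<phi> \<longleftrightarrow> compactin weak_topology ((\<lambda>\<mu>. act_bidual \<mu> \<phi>) ` cball 0 1)"
    unfolding wap ad by (rule relatively_weakly_compact_iff_compactin[OF ST])
  have B3: "right_asplund \<phi> \<longleftrightarrow>
      fragmented (subtopology weak_star_topology (cball 0 1)) dist (\<lambda>\<mu>. act_bidual \<mu> \<phi>)"
    unfolding right_asplund_def ad asplund_iff_fragmented_adjoint[symmetric] by simp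
  \<comment> \<open>Evaluating \<open>arens \<nu> \<mu>\<close> at \<open>\<phi>\<close> gives
    \<open>\<nu> (act_bidual \<mu> \<phi>)\<close>, so the supremum of the
    \<open>rho_dist \<phi>\<close> distances over the ball of \<open>\<nu>\<close> is a norm
    distance.\<close>
  have B4: "fragmented (subtopology weak_star_topology (cball 0 1)) dist (\<lambda>\<mu>. act_bidual \<mu> \<phi>) \<longleftrightarrow>
      fragmented_family (subtopology weak_star_topology (cball 0 1)) (rho_dist \<phi>)
        ((\<lambda>\<nu> \<mu>. arens \<nu> \<mu>) ` cball 0 1)"
    unfolding fragmented_eq_fragmented_family
  proof (rule fragmented_family_cong)
    fix \<mu> \<mu>' :: "'a bidual" and \<epsilon> :: real assume "\<epsilon> > 0"
    then show "(\<forall>f\<in>{\<lambda>\<mu>. act_bidual \<mu> \<phi>}. dist (f \<mu>) (f \<mu>') \<le> \<epsilon>) \<longleftrightarrow>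
        (\<forall>g\<in>(\<lambda>\<nu> \<mu>. arens \<nu> \<mu>) ` cball 0 1. rho_dist \<phi> (g \<mu>) (g \<mu>') \<le> \<epsilon>)"
      using bidual_ball_le_iff[of \<epsilon> "act_bidual \<mu> \<phi> - act_bidual \<mu>' \<phi>"]
      by (simp add: rho_dist_def rho_def dist_norm blinfun.diff_left blinfun.diff_right)
  qed
  have B5: "right_asplund \<phi> \<longleftrightarrow> separable_space (top_of_set ((\<lambda>\<mu>. act_bidual \<mu> \<phi>) ` cball 0 1))"
    if "separable_space (euclidean :: 'a topology)"
    unfolding B3 ad by (rule separable_iff_fragmented_adjoint[OF that])
  have C3: "right_tame \<phi> \<longleftrightarrow> co_tame ((\<lambda>\<mu>. act_bidual \<mu> \<phi>) ` cball 0 1)"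
    unfolding right_tame_def ad tame_iff_co_tame_adjoint[symmetric] by simp
  show ?thesis
    by (intro conjI impI A2 A3 A3[unfolded A4] A5 right_asplund_def B3 B3[unfolded B4] B5 right_tame_def C3)
qed

end
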